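(* Let $n\geq 2$ and $1\leq m\leq n-1$. There exists a function $R_{m,n}\colon \mathbb{N}_0\to\mathbb{N}_0$ such that the following holds. Let $r(z,\bar z)$ be a real-valued real-analytic function defined in a convex neighborhood $U\subset\mathbb{C}^n$ of the origin such that the complexified power series of $r$ at the origin converges in $U\times U^*$, where $U^*=\{z:\bar z\in U\}$. If $$\sup_{L\in G_{m,n}}\operatorname{rank} r|_L<\infty,$$ then $\operatorname{rank} r<\infty$, and moreover $$\operatorname{rank} r\leq R_{m,n}\Bigl(\max_{L\in G_{m,n}}\operatorname{rank} r|_L\Bigr).$$
   Context: $\mathbb{N}_0=\mathbb{N}\cup\{0\}$. $G_{m,n}$ is the affine Grassmannian: the manifold of all complex affine $m$-dimensional subspaces of $\mathbb{C}^n$. Rank. If $r$ is a real-valued real-analytic function near a point $p\in\mathbb{C}^k$, translate $p$ to the origin and dilate so that the complexified power series $\sum_{\alpha,\beta}c_{\alpha\beta}z^\alpha w^\beta$ (with $r(z,\bar z)=\sum c_{\alpha\beta}z^\alpha\bar z^\beta$) converges in a neighborhood of $\overline\Delta\times\overline\Delta$, where $\Delta$ is the unit polydisc. The matrix $C=[c_{\alpha\beta}]$ is then a Hermitian trace-class operator on $\ell^2$, and the rank of $r$ at $p$ is the rank of $C$, an element of $\mathbb{N}_0\cup\{\infty\}$. It does not depend on the dilation, and for $r$ defined on a connected open set it does not depend on $p$; this common value is $\operatorname{rank} r$. Restriction. Let $L\in G_{m,n}$. If $L$ intersects $U$, let $E\colon\mathbb{C}^m\to\mathbb{C}^n$ be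 an affine embedding with image $L$, and define $\operatorname{rank} r|_L:=\operatorname{rank}(r\circ E)$, where $r\circ E$ is considered on the connected set $E^{-1}(U)$; this does not depend on $E$. If $L$ does not intersect $U$, define $\operatorname{rank} r|_L:=-\infty$. *)

theory Defs
  imports "HOL-Analysis.Analysis" "HOL-Library.Function_Algebras"
begin

section \<open>Real-analytic functions\<close>

text \<open>Local convergent power series in the real coordinates given by the standard basis; on
  \<open>complex ^ 'k\<close> these are the real and imaginary parts of the components. Multi-indices are
  functions on the basis, extended by \<open>undefined\<close> outside it so that each occurs once.
  In finite-dimensional spaces \<open>has_sum\<close> is absolute convergence.\<close>

definition real_analytic_on :: "('a::euclidean_space \<Rightarrow> real) \<Rightarrow> 'a set \<Rightarrow> bool" where
  "real_analytic_on f U \<longleftrightarrow>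
     (\<forall>p\<in>U. \<exists>\<epsilon>>0. \<exists>a :: ('a \<Rightarrow> nat) \<Rightarrow> real. \<forall>x. norm x < \<epsilon> \<longrightarrow>
        ((\<lambda>\<gamma>. a \<gamma> * (\<Prod>b\<in>Basis. (x \<bullet> b) ^ \<gamma> b)) has_sum f (p + x))
          (Basis \<rightarrow>\<^sub>E (UNIV :: nat set)))"


section \<open>Complexified power series\<close>

definition monomial :: "complex ^ 'k \<Rightarrow> nat ^ 'k \<Rightarrow> complex" where
  "monomial z \<alpha> = (\<Prod>i\<in>UNIV. (z $ i) ^ (\<alpha> $ i))"

definition cnj_vec :: "complex ^ 'k \<Rightarrow> complex ^ 'k" where
  "cnj_vec z = (\<chi> i. cnj (z $ i))"

definition series_converges_on ::
  "(nat ^ 'k \<Rightarrow> nat ^ 'k \<Rightarrow> complex) \<Rightarrow> ((complex ^ 'k) \<times> (complex ^ 'k)) set \<Rightarrow> bool" where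
  "series_converges_on c W \<longleftrightarrow>
     (\<forall>(z, w)\<in>W. (\<lambda>(\<alpha>, \<beta>). c \<alpha> \<beta> * monomial z \<alpha> * monomial w \<beta>) summable_on UNIV)"

text \<open>\<open>c\<close> is the coefficient matrix of the complexified power series of \<open>f\<close> at \<open>p\<close>.\<close>

definition complexified_series ::
  "(complex ^ 'k \<Rightarrow> real) \<Rightarrow> complex ^ 'k \<Rightarrow> (nat ^ 'k \<Rightarrow> nat ^ 'k \<Rightarrow> complex) \<Rightarrow> bool" where
  "complexified_series f p c \<longleftrightarrow>
     (\<exists>\<epsilon>>0. series_converges_on c (ball 0 \<epsilon> \<times> ball 0 \<epsilon>) \<and>
        (\<forall>z\<in>ball 0 \<epsilon>.
           ((\<lambda>(\<alpha>, \<beta>). c \<alpha> \<beta> * monomial z \<alpha> * monomial (cnj_vec z) \<beta>)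
              has_sum complex_of_real (f (p + z))) UNIV))"


section \<open>Rank of a matrix acting on square-summable families\<close>

definition ell2 :: "('a \<Rightarrow> complex) set" where
  "ell2 = {x. (\<lambda>a. (cmod (x a))\<^sup>2) summable_on UNIV}"

definition matrix_apply :: "('a \<Rightarrow> 'a \<Rightarrow> complex) \<Rightarrow> ('a \<Rightarrow> complex) \<Rightarrow> ('a \<Rightarrow> complex)" where
  "matrix_apply C x = (\<lambda>a. \<Sum>\<^sub>\<infinity>b. C a b * x b)"

global_interpretation cfun: vector_space "\<lambda>(k::complex) (x::'a \<Rightarrow> complex) a. k * x a"
  by unfold_locales (auto simp: fun_eq_iff algebra_simps)

text \<open>The dimension of the range of the operator on \<open>ell2\<close>. The case distinction is needed
  because \<open>cfun.dim\<close> is a natural number, with a junk value in infinite dimension.\<close>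

definition operator_rank :: "('a \<Rightarrow> 'a \<Rightarrow> complex) \<Rightarrow> enat" where
  "operator_rank C =
     (if \<exists>B. finite B \<and> matrix_apply C ` ell2 \<subseteq> cfun.span B
      then enat (cfun.dim (matrix_apply C ` ell2)) else \<infinity>)"


section \<open>Rank of a real-analytic function\<close>

definition unit_polydisc :: "(complex ^ 'k) set" where
  "unit_polydisc = {z. \<forall>i. cmod (z $ i) < 1}"

text \<open>\<open>c\<close> is the matrix obtained from \<open>f\<close> by translating \<open>p\<close> to the origin and dilating by \<open>t\<close>,
  where \<open>t\<close> is small enough that the series converges near the closed unit bi-polydisc.\<close>

definition dilated_matrix ::
  "(complex ^ 'k \<Rightarrow> real) \<Rightarrow> complex ^ 'k \<Rightarrow> real \<Rightarrow> (nat ^ 'k \<Rightarrow> nat ^ 'k \<Rightarrow> complex) \<Rightarrow> bool" where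
  "dilated_matrix f p t c \<longleftrightarrow>
     t > 0 \<and> complexified_series (\<lambda>z. f (p + t *\<^sub>R z)) 0 c \<and>
     (\<exists>W. open W \<and> closure unit_polydisc \<times> closure unit_polydisc \<subseteq> W \<and>
          series_converges_on c W)"

text \<open>The value does not depend on the chosen dilation.\<close>

definition rank_at :: "(complex ^ 'k \<Rightarrow> real) \<Rightarrow> complex ^ 'k \<Rightarrow> enat" where
  "rank_at f p = operator_rank (SOME c. \<exists>t. dilated_matrix f p t c)"

text \<open>The common value of the ranks at all points of \<open>U\<close>; meaningful for \<open>f\<close> real-analytic on a
  nonempty connected open set \<open>U\<close>.\<close>

definition rank_on :: "(complex ^ 'k \<Rightarrow> real) \<Rightarrow> (complex ^ 'k) set \<Rightarrow> enat" where
  "rank_on f U = (THE \<rho>. \<forall>p\<in>U. rank_at f p = \<rho>)"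


section \<open>Restriction to affine subspaces\<close>

text \<open>Subspaces, dimension and linearity below are over the complex numbers: \<open>(*s)\<close> is
  componentwise multiplication by a complex scalar.\<close>

definition affine_grassmannian :: "nat \<Rightarrow> (complex ^ 'n) set set" where
  "affine_grassmannian m =
     {L. \<exists>p V. vec.subspace V \<and> vec.dim V = m \<and> L = (\<lambda>v. p + v) ` V}"

definition affine_embedding :: "(complex ^ 'm \<Rightarrow> complex ^ 'n) \<Rightarrow> bool" where
  "affine_embedding E \<longleftrightarrow>
     (\<exists>p A. Vector_Spaces.linear (*s) (*s) A \<and> inj A \<and> E = (\<lambda>z. p + A z))"

text \<open>For \<open>L\<close> of dimension \<open>CARD('m)\<close>; the type argument provides the space in which \<open>L\<close> is
  parametrized. The value does not depend on the chosen embedding.\<close>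

definition rank_restrict ::
  "'m::finite itself \<Rightarrow> (complex ^ 'n \<Rightarrow> real) \<Rightarrow> (complex ^ 'n) set \<Rightarrow> (complex ^ 'n) set \<Rightarrow> ereal" where
  "rank_restrict T r U L =
     (if L \<inter> U = {} then -\<infinity>
      else let E = (SOME E :: complex ^ 'm \<Rightarrow> complex ^ 'n. affine_embedding E \<and> range E = L)
           in ereal_of_enat (rank_on (r \<circ> E) (E -` U)))"

end

theory Submission
  imports Defs "HOL-Complex_Analysis.Conformal_Mappings"
begin

text \<open>The rank of \<open>r\<close> is the rank of the kernel \<open>K(z, w)\<close> obtained by complexifying \<open>r\<close>, that is,
  the least number of terms in a representation of \<open>K\<close> as a sum of products \<open>g(z) h(w)\<close>; by
  analytic continuation it may be computed on any pair of open sets. Rank at most \<open>M\<close> means that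
  the results of \<open>M\<close> steps of division-free Gaussian elimination on sampled values of \<open>K\<close> vanish.
  These are holomorphic in the parameters \<open>p, v\<close> of a line \<open>p + \<zeta> v\<close>, so polarization turns the
  hypothesis on \<open>L \<times> cnj L\<close> into rank at most \<open>M\<close> on all products of two lines, in particular of
  lines parallel to two arbitrary coordinate axes.

  Suppose a kernel has rank at most \<open>M\<close> when its second argument is restricted to any line parallel
  to a coordinate axis. Points \<open>x\<^sub>1, \<dots>, x\<^sub>s\<close>, with \<open>s \<le> M\<close> maximal, whose pivots do not vanish on one
  line parallel to the first axis have this property on a generic one, and there the kernel is a combination of
  its values on the hyperplanes through the \<open>x\<^sub>j\<close>. Iterating over the coordinates bounds the rank
  by \<open>M\<^sup>n\<close>, and doing so for both arguments by \<open>(M\<^sup>n)\<^sup>n\<close>.\<close>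

section \<open>Kernels of finite rank\<close>

text \<open>The hypothesis controls the kernel only where the line of the second argument is the
  conjugate of the line of the first, whereas slicing needs both arguments to move independently.
  The pairs (L, cnj L) form a totally real family among all pairs of lines, so equations that are
  holomorphic in the pair and hold on this family hold everywhere. Hence the rank condition is
  expressed by equations and not by the existence of factors.

  A second obstacle is that the factors found on different lines are unrelated. Fixing the pivots
  while the line varies makes them comparable: the number of pivots is maximal over all lines of a
  slice at once, so the remainder vanishes wherever the pivots do not, and the exceptional lines are
  recovered by continuing the equations. The coefficients of the resulting combination may depend on
  the line in any way; they enter only the second factor, of which no regularity is asked.

  Since every line lies in an affine subspace of dimension m, the bound does not involve m. The
  second round of slicing starts from the bound M^n of the first instead of M.\<close>

definition kernel_rank_le :: "('a \<Rightarrow> 'b \<Rightarrow> complex) \<Rightarrow> 'a set \<Rightarrow> 'b set \<Rightarrow> nat \<Rightarrow> bool" where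
  "kernel_rank_le K A B N \<longleftrightarrow>
     (\<exists>(J :: nat set) g h. finite J \<and> card J \<le> N \<and> (\<forall>a\<in>A. \<forall>b\<in>B. K a b = (\<Sum>j\<in>J. g j a * h j b)))"

text \<open>The definition must fix a type for the summation index. An enumeration of
  \<open>J\<close> admits every finite index set, such as a \<open>Sigma\<close> of index sets or a
  basis of a range.\<close>

lemma kernel_rank_leI:
  fixes J :: "'j set"
  assumes "finite J" "card J \<le> N" "\<And>a b. a \<in> A \<Longrightarrow> b \<in> B \<Longrightarrow> K a b = (\<Sum>j\<in>J. g j a * h j b)"
  shows "kernel_rank_le K A B N"
proof -
  obtain f where f: "bij_betw f {..<card J} J"
    using ex_bij_betw_nat_finite[OF assms(1)] by (metis atLeast0LessThan)
  have "K a b = (\<Sum>j\<in>{..<card J}. (g \<circ> f) j a * (h \<circ> f) j b)" if "a \<in> A" "b \<in> B" for a b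
    using sum.reindex_bij_betw[OF f, of "\<lambda>j. g j a * h j b"] assms(3)[OF that] by simp
  then show ?thesis
    unfolding kernel_rank_le_def using assms(2)
    by (intro exI[of _ "{..<card J}"] exI[of _ "g \<circ> f"] exI[of _ "h \<circ> f"]) auto
qed

lemma kernel_rank_le_mono:
  "kernel_rank_le K A B N \<Longrightarrow> A' \<subseteq> A \<Longrightarrow> B' \<subseteq> B \<Longrightarrow> N \<le> N' \<Longrightarrow> kernel_rank_le K A' B' N'"
  unfolding kernel_rank_le_def by (meson in_mono le_trans)

lemma kernel_rank_le_transpose:
  "kernel_rank_le K A B N \<Longrightarrow> kernel_rank_le (\<lambda>b a. K a b) B A N"
  unfolding kernel_rank_le_def by (subst mult.commute) blast

text \<open>Factors on the images come from choosing preimages, which is consistent because the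
  kernel sees only the image points. This moves rank bounds along dilations and affine
  embeddings.\<close>

lemma kernel_rank_le_image:
  "kernel_rank_le (\<lambda>x y. K (f x) (g y)) A B N \<longleftrightarrow> kernel_rank_le K (f ` A) (g ` B) N"
proof
  assume "kernel_rank_le K (f ` A) (g ` B) N"
  then obtain J u v where "finite J" "card J \<le> N"
    "\<forall>a\<in>f ` A. \<forall>b\<in>g ` B. K a b = (\<Sum>j\<in>(J :: nat set). u j a * v j b)"
    unfolding kernel_rank_le_def by blast
  then show "kernel_rank_le (\<lambda>x y. K (f x) (g y)) A B N"
    by (intro kernel_rank_leI[of J N A B _ "\<lambda>j. u j \<circ> f" "\<lambda>j. v j \<circ> g"]) auto
next
  assume "kernel_rank_le (\<lambda>x y. K (f x) (g y)) A B N"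
  then obtain J u v where J: "finite J" "card J \<le> N"
    "\<forall>a\<in>A. \<forall>b\<in>B. K (f a) (g b) = (\<Sum>j\<in>(J :: nat set). u j a * v j b)"
    unfolding kernel_rank_le_def by blast
  show "kernel_rank_le K (f ` A) (g ` B) N"
  proof (intro kernel_rank_leI[of J N _ _ _ "\<lambda>j. u j \<circ> inv_into A f" "\<lambda>j. v j \<circ> inv_into B g"] J(1,2))
    fix a b assume "a \<in> f ` A" "b \<in> g ` B"
    then show "K a b = (\<Sum>j\<in>J. (u j \<circ> inv_into A f) a * (v j \<circ> inv_into B g) b)"
      using J(3)[rule_format, of "inv_into A f a" "inv_into B g b"]
      by (simp add: f_inv_into_f inv_into_into)
  qed
qed

section \<open>Gaussian elimination on kernels\<close>

lemma kernel_rank_le_schur: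
  assumes "kernel_rank_le K A B (Suc N)" "a0 \<in> A" "b0 \<in> B"
  shows "kernel_rank_le (\<lambda>a b. K a0 b0 * K a b - K a b0 * K a0 b) A B N"
proof -
  obtain J g h where J: "finite (J :: nat set)" "card J \<le> Suc N"
    and K: "\<And>a b. a \<in> A \<Longrightarrow> b \<in> B \<Longrightarrow> K a b = (\<Sum>j\<in>J. g j a * h j b)"
    using assms(1) unfolding kernel_rank_le_def by blast
  show ?thesis
  proof (cases "\<forall>j\<in>J. g j a0 = 0")
    case True
    then have "K a0 b = 0" if "b \<in> B" for b
      by (simp add: K[OF assms(2) that])
    then show ?thesis
      by (intro kernel_rank_leI[of "{} :: nat set"]) (auto simp: assms(3))
  next
    case False
    then obtain k where k: "k \<in> J" "g k a0 \<noteq> 0" by blast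
    define J' where "J' = J - {k}"
    have J': "finite J'" "card J' \<le> N" "J = insert k J'" "k \<notin> J'"
      using J k by (auto simp: J'_def)
    define \<gamma> where "\<gamma> = g k a0"
    \<comment> \<open>After subtracting multiples of \<open>g k\<close>, all factors but one vanish
      at \<open>a0\<close>. Row \<open>a0\<close> is then a multiple of the single partner
      \<open>h'\<close>, and the difference of products cancels that term without a division by
      \<open>K a0 b0\<close>, which may be zero.\<close>
    define g' where "g' j a = g j a - g j a0 / \<gamma> * g k a" for j a
    define h' where "h' b = h k b + (\<Sum>j\<in>J'. g j a0 / \<gamma> * h j b)" for b
    have K': "K a b = (\<Sum>j\<in>J'. g' j a * h j b) + g k a * h' b" if "a \<in> A" "b \<in> B" for a b
      using J' by (simp add: K[OF that] g'_def h'_def algebra_simps sum_subtractf sum_distrib_left sum.distrib)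
    have g'0: "g' j a0 = 0" for j
      using k by (simp add: g'_def \<gamma>_def)
    have K0: "K a0 b = \<gamma> * h' b" if "b \<in> B" for b
      using K'[OF assms(2) that] by (simp add: g'0 \<gamma>_def)
    show ?thesis
    proof (rule kernel_rank_leI[OF J'(1,2)])
      fix a b assume ab: "a \<in> A" "b \<in> B"
      show "K a0 b0 * K a b - K a b0 * K a0 b =
          (\<Sum>j\<in>J'. (\<gamma> * g' j a) * (h' b0 * h j b - h j b0 * h' b))"
        unfolding K0[OF ab(2)] K0[OF assms(3)] K'[OF ab] K'[OF ab(1) assms(3)]
        by (simp add: algebra_simps sum_subtractf sum_distrib_left sum_distrib_right)
    qed
  qed
qed

text \<open>Division-free Gaussian elimination: \<open>s\<close> rows \<open>p\<close> and columns \<open>q\<close> have been eliminated. For a rank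
  bound this replaces determinants of varying size.\<close>

primrec elim :: "nat \<Rightarrow> ('a \<Rightarrow> 'b \<Rightarrow> complex) \<Rightarrow> (nat \<Rightarrow> 'a) \<Rightarrow> (nat \<Rightarrow> 'b) \<Rightarrow> 'a \<Rightarrow> 'b \<Rightarrow> complex" where
  "elim 0 K p q a b = K a b"
| "elim (Suc s) K p q a b =
     elim s K p q (p s) (q s) * elim s K p q a b - elim s K p q a (q s) * elim s K p q (p s) b"

lemma elim_cong:
  "(\<And>k. k < s \<Longrightarrow> p k = p' k) \<Longrightarrow> (\<And>k. k < s \<Longrightarrow> q k = q' k) \<Longrightarrow>
   elim s K p q a b = elim s K p' q' a b"
  by (induction s arbitrary: a b) auto

lemma kernel_rank_le_elim:
  assumes "kernel_rank_le K A B N" "s \<le> N" "\<And>k. k < s \<Longrightarrow> p k \<in> A" "\<And>k. k < s \<Longrightarrow> q k \<in> B"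
  shows "kernel_rank_le (elim s K p q) A B (N - s)"
  using assms(2-)
proof (induction s)
  case 0
  then show ?case
    using assms(1) by (auto simp: kernel_rank_le_def)
next
  case (Suc s)
  have "kernel_rank_le (elim s K p q) A B (Suc (N - Suc s))"
    using Suc by (simp add: Suc_diff_Suc)
  then have "kernel_rank_le (\<lambda>a b. elim s K p q (p s) (q s) * elim s K p q a b -
      elim s K p q a (q s) * elim s K p q (p s) b) A B (N - Suc s)"
    by (rule kernel_rank_le_schur) (use Suc in auto)
  then show ?case
    by (simp add: kernel_rank_le_def)
qed

text \<open>Corresponds to the vanishing of the minors of order \<open>N + 1\<close>:
  \<open>N\<close> eliminations leave rank 0. Row \<open>p N\<close> and column \<open>q N\<close>
  are sampled but not eliminated.\<close>

lemma elim_eq_0: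
  assumes "kernel_rank_le K A B N" "\<And>k. k \<le> N \<Longrightarrow> p k \<in> A" "\<And>k. k \<le> N \<Longrightarrow> q k \<in> B"
  shows "elim N K p q (p N) (q N) = 0"
  using kernel_rank_le_elim[OF assms(1) order_refl, of p q] assms(2,3)
  by (force simp: kernel_rank_le_def)

text \<open>The leading coefficient is the product of the pivots. The numbers \<open>c k\<close>
  depend on \<open>b\<close> but not on \<open>a\<close>, so this is a linear relation between whole
  columns of \<open>K\<close>.\<close>

lemma elim_expand:
  "\<exists>c. \<forall>a. elim s K p q a b =
     (\<Prod>k<s. elim k K p q (p k) (q k)) * K a b - (\<Sum>k<s. K a (q k) * c k)"
proof (induction s arbitrary: b)
  case 0
  then show ?case by auto
next
  case (Suc s)
  define \<kappa> where "\<kappa> = (\<Prod>k<s. elim k K p q (p k) (q k))"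
  obtain c where c: "\<And>a. elim s K p q a b = \<kappa> * K a b - (\<Sum>k<s. K a (q k) * c k)"
    using Suc.IH[of b] unfolding \<kappa>_def by blast
  obtain d where d: "\<And>a. elim s K p q a (q s) = \<kappa> * K a (q s) - (\<Sum>k<s. K a (q k) * d k)"
    using Suc.IH[of "q s"] unfolding \<kappa>_def by blast
  define \<pi> where "\<pi> = elim s K p q (p s) (q s)"
  define \<eta> where "\<eta> = elim s K p q (p s) b"
  have "elim (Suc s) K p q a b = (\<Prod>k<Suc s. elim k K p q (p k) (q k)) * K a b -
      (\<Sum>k<Suc s. K a (q k) * (if k < s then \<pi> * c k - \<eta> * d k else \<kappa> * \<eta>))" for a
  proof -
    have "elim (Suc s) K p q a b = \<pi> * elim s K p q a b - elim s K p q a (q s) * \<eta>"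
      by (simp add: \<pi>_def \<eta>_def)
    also have "\<dots> = \<pi> * (\<kappa> * K a b - (\<Sum>k<s. K a (q k) * c k)) -
        (\<kappa> * K a (q s) - (\<Sum>k<s. K a (q k) * d k)) * \<eta>"
      by (simp only: c[of a] d[of a])
    also have "\<dots> = \<kappa> * \<pi> * K a b - ((\<Sum>k<s. K a (q k) * (\<pi> * c k - \<eta> * d k)) + K a (q s) * (\<kappa> * \<eta>))"
      by (simp add: algebra_simps sum_subtractf sum_distrib_left)
    finally show ?thesis
      by (simp flip: \<kappa>_def \<pi>_def)
  qed
  then show ?case
    by (intro exI[of _ "\<lambda>k. if k < s then \<pi> * c k - \<eta> * d k else \<kappa> * \<eta>"]) blast
qed

text \<open>A form of Cramer's rule: one may divide by the product of the pivots, and a vanishing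
  remainder expresses column \<open>b\<close> through the pivot columns.\<close>

lemma elim_solve:
  assumes "\<And>k. k < s \<Longrightarrow> elim k K p q (p k) (q k) \<noteq> 0" "\<And>a. a \<in> A \<Longrightarrow> elim s K p q a b = 0"
  shows "\<exists>c. \<forall>a\<in>A. K a b = (\<Sum>k<s. K a (q k) * c k)"
proof -
  define \<kappa> where "\<kappa> = (\<Prod>k<s. elim k K p q (p k) (q k))"
  obtain c where c: "\<And>a. elim s K p q a b = \<kappa> * K a b - (\<Sum>k<s. K a (q k) * c k)"
    using elim_expand[of s K p q b] unfolding \<kappa>_def by blast
  have "\<kappa> \<noteq> 0"
    using assms(1) by (simp add: \<kappa>_def)
  have "K a b = (\<Sum>k<s. K a (q k) * (c k / \<kappa>))" if "a \<in> A" for a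
  proof -
    have "\<kappa> * K a b = (\<Sum>k<s. K a (q k) * c k)"
      using c[of a] assms(2)[OF that] by simp
    then show ?thesis
      using \<open>\<kappa> \<noteq> 0\<close> by (simp add: field_simps flip: sum_divide_distrib)
  qed
  then show ?thesis by (intro exI[of _ "\<lambda>k. c k / \<kappa>"]) auto
qed

lemma ex_last_nat:
  fixes P :: "nat \<Rightarrow> bool"
  assumes "P 0" "\<not> P (Suc N)"
  obtains s where "s \<le> N" "P s" "\<not> P (Suc s)"
  using assms
proof (induction N arbitrary: thesis)
  case (Suc N)
  show ?case
  proof (cases "P (Suc N)")
    case True
    then show ?thesis using Suc.prems by blast
  next
    case False
    then obtain s where "s \<le> N" "P s" "\<not> P (Suc s)"
      using Suc.IH Suc.prems(2) by blast
    then show ?thesis using Suc.prems(1)[of s] by simp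
  qed
qed blast

text \<open>Take a run of nonzero pivots that is followed by no longer one. A nonzero remainder at
  (\<open>a\<close>, \<open>b\<close>) would supply one more pivot, so all remainders vanish and the
  pivot columns span.\<close>

lemma elim_skeleton:
  assumes "\<And>p q. range p \<subseteq> A \<Longrightarrow> range q \<subseteq> B \<Longrightarrow> elim N K p q (p N) (q N) = 0"
  obtains s q c where "s \<le> N" "\<And>k. k < s \<Longrightarrow> q k \<in> B"
    "\<And>a b. a \<in> A \<Longrightarrow> b \<in> B \<Longrightarrow> K a b = (\<Sum>k<s. K a (q k) * c k b)"
proof (cases "A = {} \<or> B = {}")
  case True
  then show ?thesis
    using that[of 0] by auto
next
  case False
  define P where "P s \<longleftrightarrow> (\<exists>p q. range p \<subseteq> A \<and> range q \<subseteq> B \<and>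
    (\<forall>k<s. elim k K p q (p k) (q k) \<noteq> 0))" for s
  obtain a0 b0 where "a0 \<in> A" "b0 \<in> B"
    using False by blast
  then have "P 0"
    unfolding P_def by (intro exI[of _ "\<lambda>_. a0"] exI[of _ "\<lambda>_. b0"]) auto
  moreover have "\<not> P (Suc N)"
    using assms unfolding P_def by blast
  ultimately obtain s where s: "s \<le> N" "P s" "\<not> P (Suc s)"
    by (rule ex_last_nat)
  then obtain p q where pq: "range p \<subseteq> A" "range q \<subseteq> B"
    "\<And>k. k < s \<Longrightarrow> elim k K p q (p k) (q k) \<noteq> 0"
    unfolding P_def by blast
  have 0: "elim s K p q a b = 0" if "a \<in> A" "b \<in> B" for a b
  proof (rule ccontr)
    assume nz: "elim s K p q a b \<noteq> 0"
    have e: "elim k K (p(s := a)) (q(s := b)) = elim k K p q" if "k \<le> s" for k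
      using that by (intro ext elim_cong) auto
    have "P (Suc s)"
      unfolding P_def
      by (rule exI[of _ "p(s := a)"], rule exI[of _ "q(s := b)"])
         (use pq that nz in \<open>auto simp: less_Suc_eq e\<close>)
    then show False using s by blast
  qed
  have "\<forall>b. \<exists>c. b \<in> B \<longrightarrow> (\<forall>a\<in>A. K a b = (\<Sum>k<s. K a (q k) * c k))"
    using elim_solve[OF pq(3), where A = A] 0 by blast
  then obtain c where "\<And>b. b \<in> B \<Longrightarrow> \<forall>a\<in>A. K a b = (\<Sum>k<s. K a (q k) * c b k)"
    by metis
  then show ?thesis
    by (intro that[of s q "\<lambda>k b. c b k"]) (use s pq(2) in auto)
qed

text \<open>Nothing is known about the factors in \<open>kernel_rank_le\<close>. Here one family of
  them consists of columns of \<open>K\<close> itself, which share the summability of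
  \<open>K\<close> in the first variable.\<close>

lemma kernel_rank_le_skeleton:
  assumes "kernel_rank_le K A B N"
  shows "\<exists>s\<le>N. \<exists>q c. (\<forall>k<s. q k \<in> B) \<and> (\<forall>a\<in>A. \<forall>b\<in>B. K a b = (\<Sum>k<s. K a (q k) * c k b))"
proof (rule elim_skeleton)
  show "elim N K p q (p N) (q N) = 0" if "range p \<subseteq> A" "range q \<subseteq> B" for p q
    using that by (intro elim_eq_0[OF assms]) auto
  fix s q c
  assume s: "s \<le> N" and q: "\<And>k. k < s \<Longrightarrow> q k \<in> B"
    and eq: "\<And>a b. a \<in> A \<Longrightarrow> b \<in> B \<Longrightarrow> K a b = (\<Sum>k<s. K a (q k) * c k b)"
  show ?thesis
    by (intro exI[of _ s] conjI exI[of _ q] exI[of _ c] allI impI ballI s q eq)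
qed

text \<open>Turns the existence of factors into polynomial equations in sampled values of the
  kernel, which identity theorems can propagate.\<close>

lemma kernel_rank_le_iff_elim:
  "kernel_rank_le K A B N \<longleftrightarrow>
    (\<forall>p q. range p \<subseteq> A \<longrightarrow> range q \<subseteq> B \<longrightarrow> elim N K p q (p N) (q N) = 0)"
proof
  assume *: "\<forall>p q. range p \<subseteq> A \<longrightarrow> range q \<subseteq> B \<longrightarrow> elim N K p q (p N) (q N) = 0"
  obtain s q c where sq: "s \<le> N" "\<And>k. k < s \<Longrightarrow> q k \<in> B"
    "\<And>a b. a \<in> A \<Longrightarrow> b \<in> B \<Longrightarrow> K a b = (\<Sum>k<s. K a (q k) * c k b)"
    by (rule elim_skeleton[of A B N K]) (use * in blast)+
  show "kernel_rank_le K A B N"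
    by (rule kernel_rank_leI[of "{..<s}" N A B K "\<lambda>k a. K a (q k)" c]) (use sq in auto)
next
  assume "kernel_rank_le K A B N"
  then show "\<forall>p q. range p \<subseteq> A \<longrightarrow> range q \<subseteq> B \<longrightarrow> elim N K p q (p N) (q N) = 0"
    by (auto intro!: elim_eq_0)
qed

section \<open>Holomorphy along complex lines\<close>

text \<open>One parameter moves both arguments, so these are the complex lines of the product space.
  All continuation runs along such lines, and function theory of one variable suffices.\<close>

definition gateaux_holomorphic :: "(complex ^ 'k \<Rightarrow> complex ^ 'l \<Rightarrow> complex) \<Rightarrow>
    (complex ^ 'k) set \<Rightarrow> (complex ^ 'l) set \<Rightarrow> bool" where
  "gateaux_holomorphic K A B \<longleftrightarrow> (\<forall>z\<in>A. \<forall>w\<in>B. \<forall>u v.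
     (\<lambda>t. K (z + t *s u) (w + t *s v)) field_differentiable at 0)"

lemma continuous_on_vector_line [continuous_intros]:
  "continuous_on S (\<lambda>t. z + t *s u :: complex ^ 'k)"
  unfolding vector_scalar_mult_def by (intro continuous_intros)

lemma open_line_preimage: "open A \<Longrightarrow> open {t. z + t *s u \<in> (A :: (complex ^ 'k) set)}"
  using open_vimage[of A "\<lambda>t. z + t *s u"] continuous_on_vector_line[of UNIV z u]
  by (simp add: vimage_def)

lemma convex_line_preimage:
  assumes "convex A" shows "convex {t. z + t *s u \<in> (A :: (complex ^ 'k) set)}"
proof (rule convexI)
  fix x y :: complex and a b :: real
  assume *: "x \<in> {t. z + t *s u \<in> A}" "y \<in> {t. z + t *s u \<in> A}" "0 \<le> a" "0 \<le> b" "a + b = 1"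
  have "a *\<^sub>R z + b *\<^sub>R z = z"
    using *(5) by (metis scaleR_add_left scaleR_one)
  then have "z + (a *\<^sub>R x + b *\<^sub>R y) *s u = a *\<^sub>R (z + x *s u) + b *\<^sub>R (z + y *s u)"
    by (simp add: vec_eq_iff algebra_simps)
  then show "a *\<^sub>R x + b *\<^sub>R y \<in> {t. z + t *s u \<in> A}"
    using convexD[OF assms, of "z + x *s u" "z + y *s u" a b] * by simp
qed

lemma gateaux_holomorphic_mono:
  "gateaux_holomorphic K A B \<Longrightarrow> A' \<subseteq> A \<Longrightarrow> B' \<subseteq> B \<Longrightarrow> gateaux_holomorphic K A' B'"
  unfolding gateaux_holomorphic_def by blast

text \<open>Differentiability is postulated at parameter 0 only; for another parameter
  \<open>x\<close> the base points are moved to \<open>z + x *s u\<close> and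
  \<open>w + x *s v\<close>.\<close>

lemma gateaux_holomorphic_line:
  assumes "gateaux_holomorphic K A B" "\<And>t. t \<in> S \<Longrightarrow> z + t *s u \<in> A \<and> w + t *s v \<in> B"
  shows "(\<lambda>t. K (z + t *s u) (w + t *s v)) holomorphic_on S"
proof -
  have "(\<lambda>t. K (z + t *s u) (w + t *s v)) field_differentiable at x within S" if "x \<in> S" for x
  proof -
    have "(\<lambda>t. K ((z + x *s u) + t *s u) ((w + x *s v) + t *s v)) field_differentiable at (x - x)"
      using assms that unfolding gateaux_holomorphic_def by auto
    then have "(\<lambda>t. K (z + (t + x) *s u) (w + (t + x) *s v)) field_differentiable at (x - x)"
      by (simp add: vec.scale_left_distrib algebra_simps)
    moreover have "(\<lambda>t. t - x) field_differentiable at x"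
      by (intro derivative_intros)
    ultimately have "((\<lambda>t. K (z + (t + x) *s u) (w + (t + x) *s v)) \<circ> (\<lambda>t. t - x)) field_differentiable at x"
      by (intro field_differentiable_compose)
    then show ?thesis
      by (simp add: o_def field_differentiable_at_within)
  qed
  then show ?thesis
    unfolding holomorphic_on_def by blast
qed

lemma gateaux_holomorphic_swap:
  "gateaux_holomorphic K A B \<Longrightarrow> gateaux_holomorphic (\<lambda>w z. K z w) B A"
  unfolding gateaux_holomorphic_def by blast

lemma gateaux_holomorphic_line_right:
  assumes "gateaux_holomorphic K A B" "a \<in> A" "\<And>t. t \<in> S \<Longrightarrow> w + t *s v \<in> B"
  shows "(\<lambda>t. K a (w + t *s v)) holomorphic_on S"
  using gateaux_holomorphic_line[OF assms(1), of S a 0 w v] assms(2,3) by simp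

lemma holomorphic_on_elim:
  assumes "\<And>i j. i \<le> N \<Longrightarrow> j \<le> N \<Longrightarrow> (\<lambda>t. K t (p t i) (q t j)) holomorphic_on S"
    and "s \<le> N" "i \<le> N" "j \<le> N"
  shows "(\<lambda>t. elim s (K t) (p t) (q t) (p t i) (q t j)) holomorphic_on S"
  using assms(2-) by (induction s arbitrary: i j) (auto intro!: holomorphic_intros assms(1))

section \<open>Analytic continuation of rank bounds\<close>

lemma holomorphic_eq_0_near:
  assumes "g holomorphic_on S" "open S" "convex S" "x \<in> S" "y \<in> S" "eventually (\<lambda>t. g t = 0) (nhds x)"
  shows "g y = 0"
proof -
  obtain T where T: "open T" "x \<in> T" "\<And>t. t \<in> T \<Longrightarrow> g t = 0"
    using assms(6) unfolding eventually_nhds by blast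
  show ?thesis
  proof (rule analytic_continuation[of g S "T \<inter> S" x y])
    show "x islimpt T \<inter> S"
      using T assms by (intro interior_limit_point) (auto simp: interior_open open_Int)
  qed (use assms T in \<open>auto simp: convex_connected\<close>)
qed

lemma eventually_nhds_line:
  "open V \<Longrightarrow> z \<in> V \<Longrightarrow> eventually (\<lambda>t. z + t *s u \<in> V) (nhds (0 :: complex))"
  using open_line_preimage[of V z u] unfolding eventually_nhds
  by (intro exI[of _ "{t. z + t *s u \<in> V}"]) auto

text \<open>All sampled columns are contracted towards \<open>y\<close> with one parameter: near 0
  they lie in \<open>B'\<close>, where elimination ends in 0, and at 1 they are the given ones. The
  set \<open>B'\<close> is tested only along lines from \<open>y\<close> to points of
  \<open>B\<close>, so it may be open merely relative to an affine slice.\<close>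

lemma kernel_rank_le_extend:
  fixes K :: "'a \<Rightarrow> complex ^ 'n \<Rightarrow> complex"
  assumes "open V" "convex V"
    and hol: "\<And>a w v S. a \<in> A \<Longrightarrow> (\<And>t. t \<in> S \<Longrightarrow> w + t *s v \<in> V) \<Longrightarrow> (\<lambda>t. K a (w + t *s v)) holomorphic_on S"
    and "B \<subseteq> V" "y \<in> V"
    and near: "\<And>b. b \<in> B \<Longrightarrow> eventually (\<lambda>t. y + t *s (b - y) \<in> B') (nhds 0)"
    and "kernel_rank_le K A B' N"
  shows "kernel_rank_le K A B N"
  unfolding kernel_rank_le_iff_elim
proof (intro allI impI)
  fix p :: "nat \<Rightarrow> 'a" and q :: "nat \<Rightarrow> complex ^ 'n"
  assume p: "range p \<subseteq> A" and q: "range q \<subseteq> B"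
  define S where "S = (\<Inter>j\<in>{..N}. {t. y + t *s (q j - y) \<in> V})"
  define g where "g t = elim N K p (\<lambda>j. y + t *s (q j - y)) (p N) (y + t *s (q N - y))" for t
  have S: "open S" "convex S"
    unfolding S_def by (intro open_INT convex_INT ballI open_line_preimage convex_line_preimage assms(1,2); simp)+
  have mem: "0 \<in> S" "1 \<in> S"
    unfolding S_def using assms(4,5) q by auto
  have "g holomorphic_on S"
    unfolding g_def
  proof (rule holomorphic_on_elim[where K = "\<lambda>_. K" and p = "\<lambda>_. p" and N = N])
    show "(\<lambda>t. K (p i) (y + t *s (q j - y))) holomorphic_on S" if "j \<le> N" for i j
      by (rule hol) (use p that in \<open>auto simp: S_def\<close>)
  qed auto
  moreover have "eventually (\<lambda>t. g t = 0) (nhds 0)"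
  proof -
    have "eventually (\<lambda>t. \<forall>j\<in>{..N}. y + t *s (q j - y) \<in> B') (nhds 0)"
      using near q by (intro eventually_ball_finite) auto
    then show ?thesis
      by eventually_elim (use p in \<open>auto simp: g_def intro!: elim_eq_0[OF assms(7)]\<close>)
  qed
  ultimately have "g 1 = 0"
    using holomorphic_eq_0_near S mem by blast
  then show "elim N K p q (p N) (q N) = 0"
    by (simp add: g_def)
qed

lemma gateaux_kernel_rank_le_extend:
  fixes K :: "complex ^ 'k \<Rightarrow> complex ^ 'l \<Rightarrow> complex"
  assumes K: "gateaux_holomorphic K A B"
    and "open A" "convex A" "open B" "convex B"
    and "open A'" "A' \<subseteq> A" "x \<in> A'" "open B'" "B' \<subseteq> B" "y \<in> B'"
    and "kernel_rank_le K A' B' N"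
  shows "kernel_rank_le K A B N"
proof -
  have near: "eventually (\<lambda>t. y + t *s (b - y) \<in> B') (nhds 0)" if "b \<in> B" for b
    using assms that by (intro eventually_nhds_line) auto
  have near': "eventually (\<lambda>t. x + t *s (b - x) \<in> A') (nhds 0)" if "b \<in> A" for b
    using assms that by (intro eventually_nhds_line) auto
  have "kernel_rank_le K A' B N"
    by (rule kernel_rank_le_extend[of B A' K B y B'])
       (use assms near in \<open>auto intro!: gateaux_holomorphic_line_right[OF K]\<close>)
  then have "kernel_rank_le (\<lambda>b a. K a b) B A' N"
    by (rule kernel_rank_le_transpose)
  then have "kernel_rank_le (\<lambda>b a. K a b) B A N"
    by (intro kernel_rank_le_extend[of A B "\<lambda>b a. K a b" A x A' N])
       (use assms near' in \<open>auto intro!: gateaux_holomorphic_line_right[OF gateaux_holomorphic_swap[OF K]]\<close>)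
  then show ?thesis
    by (rule kernel_rank_le_transpose[where K = "\<lambda>b a. K a b"])
qed

text \<open>The identity theorem on the real diameter. Radius 2 leaves room for the point \<i>, at
  which polarization is read off.\<close>

lemma holomorphic_eq_0_real:
  assumes "g holomorphic_on ball 0 2" "\<And>t :: real. \<bar>t\<bar> < 2 \<Longrightarrow> g (of_real t) = 0"
  shows "g \<i> = 0"
proof (rule analytic_continuation[of g "ball 0 2" "of_real ` {-2<..<2}" 0 \<i>])
  show "0 islimpt complex_of_real ` {-2<..<2}"
    unfolding islimpt_approachable
  proof (intro allI impI)
    fix e :: real assume "e > 0"
    then show "\<exists>x'\<in>complex_of_real ` {-2<..<2}. x' \<noteq> 0 \<and> dist x' 0 < e"
      by (intro bexI[of _ "of_real (min (e/2) 1)"]) (auto simp: min_def)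
  qed
qed (use assms in \<open>auto simp: norm_mult\<close>)

section \<open>Slicing along the coordinate axes\<close>

definition polydisc :: "real \<Rightarrow> (complex ^ 'k) set" where
  "polydisc \<delta> = {z. \<forall>i. cmod (z $ i) < \<delta>}"

lemma open_polydisc: "open (polydisc \<delta>)"
  unfolding polydisc_def Collect_all_eq by (intro open_INT ballI open_Collect_less continuous_intros) auto

lemma convex_polydisc: "convex (polydisc \<delta>)"
proof -
  have "polydisc \<delta> = (\<Inter>i. {z :: complex ^ 'k. z $ i \<in> ball 0 \<delta>})"
    by (auto simp: polydisc_def)
  moreover have "convex {z :: complex ^ 'k. z $ i \<in> ball 0 \<delta>}" for i
    using convex_linear_vimage[OF bounded_linear.linear[OF bounded_linear_vec_nth], of "ball 0 \<delta>" i] by (simp add: vimage_def)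
  ultimately show ?thesis
    by (metis convex_INT)
qed

definition vec_upd :: "complex ^ 'k \<Rightarrow> 'k \<Rightarrow> complex \<Rightarrow> complex ^ 'k" where
  "vec_upd w i x = (\<chi> j. if j = i then x else w $ j)"

lemma vec_upd_nth: "vec_upd w i x $ j = (if j = i then x else w $ j)"
  by (simp add: vec_upd_def)

text \<open>Overwriting a coordinate maps complex lines to complex lines, so values of a kernel on
  the hyperplanes stay holomorphic in the parameter.\<close>

lemma vec_upd_line: "vec_upd (y + t *s d) i x = vec_upd y i x + t *s vec_upd d i 0"
  by (simp add: vec_eq_iff vec_upd_nth)

lemma vec_upd_same: "vec_upd w i (w $ i) = w"
  by (simp add: vec_eq_iff vec_upd_nth)

text \<open>Induction on the set of free coordinates, each of which costs a factor \<open>M\<close>.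
  The rows \<open>u\<close> and the heights \<open>x\<close> of the pivots are chosen once and kept
  while the line moves; sampling at a fixed height leaves one free coordinate fewer.\<close>

lemma kernel_rank_le_polydisc:
  fixes K :: "'a \<Rightarrow> complex ^ 'n \<Rightarrow> complex"
  assumes hol: "\<And>a w v S. a \<in> A \<Longrightarrow> (\<And>t. t \<in> S \<Longrightarrow> w + t *s v \<in> polydisc \<delta>) \<Longrightarrow>
      (\<lambda>t. K a (w + t *s v)) holomorphic_on S"
    and lines: "\<And>i p. p \<in> polydisc \<delta> \<Longrightarrow>
      kernel_rank_le K A {w\<in>polydisc \<delta>. \<forall>j. j \<noteq> i \<longrightarrow> w $ j = p $ j} M"
  shows "kernel_rank_le K A (polydisc \<delta>) (M ^ CARD('n))"
proof -
  let ?P = "polydisc \<delta> :: (complex ^ 'n) set"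
  define slice where "slice S p = {w\<in>?P. \<forall>j. j \<notin> S \<longrightarrow> w $ j = p $ j}" for S p
  have slices: "kernel_rank_le K A (slice S p) (M ^ card S)" if "finite S" "p \<in> ?P" for S p
    using that
  proof (induction S arbitrary: p)
    case empty
    \<comment> \<open>Without free coordinates the slice is a point, and the rank is at most 1 =
      \<open>M ^ 0\<close>.\<close>
    have "slice {} p \<subseteq> {p}"
      by (auto simp: slice_def vec_eq_iff)
    then show ?case
      by (intro kernel_rank_leI[of "{0 :: nat}" _ _ _ _ "\<lambda>_ a. K a p" "\<lambda>_ _. 1"]) auto
  next
    case (insert i S)
    define B where "B = slice (insert i S) p"
    define N where "N = M ^ card S"
    have upd: "vec_upd w i x \<in> ?P" if "w \<in> ?P" "cmod x < \<delta>" for w x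
      using that by (auto simp: polydisc_def vec_upd_nth)
    define pivots where "pivots s u x w \<longleftrightarrow>
      (\<forall>k<s. elim k K u (\<lambda>k. vec_upd w i (x k)) (u k) (vec_upd w i (x k)) \<noteq> 0)" for s u x w
    \<comment> \<open>The point \<open>w\<close> selects the line parallel to axis \<open>i\<close>.
      Letting it range over all of \<open>B\<close> makes the choice of \<open>s\<close> binding on
      every line of the slice and not only on the line through \<open>y\<close>.\<close>
    define Q where "Q s \<longleftrightarrow>
      (\<exists>u x. \<exists>w\<in>B. range u \<subseteq> A \<and> (\<forall>k. cmod (x k) < \<delta>) \<and> pivots s u x w)" for s
    show ?case
    proof (cases "A = {}")
      case True
      then show ?thesis
        by (auto simp: kernel_rank_le_def)
    next
      case False
      then obtain a0 where "a0 \<in> A" by blast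
      have "p \<in> B" using insert.prems by (auto simp: B_def slice_def)
      have "Q 0"
        unfolding Q_def pivots_def
        by (rule exI[of _ "\<lambda>_. a0"], rule exI[of _ "\<lambda>_. p $ i"], rule bexI[of _ p])
           (use \<open>a0 \<in> A\<close> \<open>p \<in> B\<close> insert.prems in \<open>auto simp: polydisc_def\<close>)
      moreover have "\<not> Q (Suc M)"
      proof
        assume "Q (Suc M)"
        then obtain u x w where *: "w \<in> B" "range u \<subseteq> A" "\<And>k. cmod (x k) < \<delta>" "pivots (Suc M) u x w"
          unfolding Q_def by blast
        have "w \<in> ?P" using * by (auto simp: B_def slice_def)
        have "elim M K u (\<lambda>k. vec_upd w i (x k)) (u M) (vec_upd w i (x M)) = 0"
          by (rule elim_eq_0[OF lines[OF \<open>w \<in> ?P\<close>, of i]])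
             (use * upd[OF \<open>w \<in> ?P\<close>] in \<open>auto simp: vec_upd_nth\<close>)
        then show False using * by (auto simp: pivots_def)
      qed
      ultimately obtain s where s: "s \<le> M" "Q s" "\<not> Q (Suc s)"
        by (rule ex_last_nat)
      then obtain u x y where y: "y \<in> B" and u: "range u \<subseteq> A" and x: "\<And>k. cmod (x k) < \<delta>"
        and piv: "pivots s u x y"
        unfolding Q_def by blast
      define B' where "B' = {w\<in>B. pivots s u x w}"
      have B_P: "B \<subseteq> ?P" by (auto simp: B_def slice_def)
      \<comment> \<open>If the remainder did not vanish, \<open>a\<close> and the height
        \<open>w $ i\<close> of \<open>w\<close> itself would give one more pivot on the line
        through \<open>w\<close>, against the choice of \<open>s\<close>.\<close>
      have solve: "\<exists>c. \<forall>a\<in>A. K a w = (\<Sum>k<s. K a (vec_upd w i (x k)) * c k)" if "w \<in> B'" for w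
      proof (rule elim_solve[where p = u])
        show "elim s K u (\<lambda>k. vec_upd w i (x k)) a w = 0" if "a \<in> A" for a
        proof (rule ccontr)
          assume nz: "elim s K u (\<lambda>k. vec_upd w i (x k)) a w \<noteq> 0"
          have e: "elim k K (u(s := a)) (\<lambda>k. vec_upd w i (if k = s then w $ i else x k)) =
              elim k K u (\<lambda>k. vec_upd w i (x k))" if "k \<le> s" for k
            using that by (intro ext elim_cong) auto
          have "pivots (Suc s) (u(s := a)) (x(s := w $ i)) w"
            using \<open>w \<in> B'\<close> nz unfolding pivots_def B'_def
            by (auto simp: less_Suc_eq e vec_upd_same)
          moreover have "w \<in> B" "cmod (w $ i) < \<delta>"
            using \<open>w \<in> B'\<close> B_P by (auto simp: B'_def polydisc_def)
          ultimately have "Q (Suc s)"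
            unfolding Q_def using u x \<open>a \<in> A\<close>
            by (intro exI[of _ "u(s := a)"] exI[of _ "x(s := w $ i)"] bexI[of _ w]) auto
          then show False using s by blast
        qed
      qed (use that in \<open>auto simp: B'_def pivots_def\<close>)
      have "\<forall>w. \<exists>c. w \<in> B' \<longrightarrow> (\<forall>a\<in>A. K a w = (\<Sum>k<s. K a (vec_upd w i (x k)) * c k))"
        using solve by blast
      then obtain c where c: "\<And>w a. w \<in> B' \<Longrightarrow> a \<in> A \<Longrightarrow>
          K a w = (\<Sum>k<s. K a (vec_upd w i (x k)) * c w k)"
        by metis
      \<comment> \<open>Coordinate \<open>i\<close> is frozen at \<open>x k\<close>, so the
        induction hypothesis applies on this hyperplane, with the base point moved there.\<close>
      have "\<forall>k. \<exists>J g h. finite (J :: nat set) \<and> card J \<le> N \<and>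
          (\<forall>a\<in>A. \<forall>w\<in>slice S (vec_upd p i (x k)). K a w = (\<Sum>j\<in>J. g j a * h j w))"
        using insert.IH[OF upd[OF insert.prems x]] unfolding kernel_rank_le_def N_def by blast
      then obtain J g h where J: "\<And>k. finite (J k :: nat set)" "\<And>k. card (J k) \<le> N"
        and gh: "\<And>k a w. a \<in> A \<Longrightarrow> w \<in> slice S (vec_upd p i (x k)) \<Longrightarrow>
          K a w = (\<Sum>j\<in>J k. g k j a * h k j w)"
        by metis
      have "kernel_rank_le K A B' (s * N)"
      proof (rule kernel_rank_leI[of "Sigma {..<s} J"])
        show "card (Sigma {..<s} J) \<le> s * N"
          using sum_mono[of "{..<s}" "\<lambda>k. card (J k)" "\<lambda>_. N"] J by (simp add: card_SigmaI)
      next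
        fix a w assume "a \<in> A" "w \<in> B'"
        have "vec_upd w i (x k) \<in> slice S (vec_upd p i (x k))" for k
          using \<open>w \<in> B'\<close> x upd by (auto simp: slice_def B'_def B_def vec_upd_nth)
        then have "K a (vec_upd w i (x k)) = (\<Sum>j\<in>J k. g k j a * h k j (vec_upd w i (x k)))" for k
          by (rule gh[OF \<open>a \<in> A\<close>])
        then have "K a w = (\<Sum>k<s. (\<Sum>j\<in>J k. g k j a * h k j (vec_upd w i (x k))) * c w k)"
          using c[OF \<open>w \<in> B'\<close> \<open>a \<in> A\<close>] by (simp only:)
        \<comment> \<open>The coefficient \<open>c w k\<close> depends on \<open>w\<close> alone and
          is absorbed into the second factor.\<close>
        also have "\<dots> = (\<Sum>(k, j)\<in>Sigma {..<s} J. g k j a * (h k j (vec_upd w i (x k)) * c w k))"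
          using J(1) by (subst sum.Sigma[symmetric]) (auto simp: sum_distrib_right mult.assoc)
        finally show "K a w = (\<Sum>kj\<in>Sigma {..<s} J.
            g (fst kj) (snd kj) a * (h (fst kj) (snd kj) (vec_upd w i (x (fst kj))) * c w (fst kj)))"
          by (simp add: case_prod_unfold)
      qed (use J(1) in auto)
      \<comment> \<open>From lines with nonzero pivots to all lines of the slice: the pivots are
        nonzero at \<open>y\<close> and, by continuity, for small parameters on each line from
        \<open>y\<close> to a point of \<open>B\<close>.\<close>
      then have "kernel_rank_le K A B (s * N)"
      proof (rule kernel_rank_le_extend[rotated -1])
        show "y \<in> ?P" using y B_P by blast
        fix b assume "b \<in> B"
        define V where "V k = {t. vec_upd (y + t *s (b - y)) i (x k) \<in> ?P}" for k
        define R where "R = {t. y + t *s (b - y) \<in> ?P}"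
        have "open R"
          unfolding R_def by (rule open_line_preimage[OF open_polydisc])
        moreover have "0 \<in> R"
          using \<open>y \<in> ?P\<close> by (simp add: R_def)
        ultimately have R: "open R" "0 \<in> R" .
        have inP: "vec_upd y i (x k) + t *s vec_upd (b - y) i 0 \<in> ?P" if "t \<in> R" for t k
          using upd that x by (auto simp: R_def simp flip: vec_upd_line)
        have hol': "(\<lambda>t. elim k K u (\<lambda>k. vec_upd (y + t *s (b - y)) i (x k)) (u k)
            (vec_upd (y + t *s (b - y)) i (x k))) holomorphic_on R" for k
        proof (rule holomorphic_on_elim[where K = "\<lambda>_. K" and p = "\<lambda>_. u" and N = k])
          show "(\<lambda>t. K (u l) (vec_upd (y + t *s (b - y)) i (x j))) holomorphic_on R" for l j
            unfolding vec_upd_line by (rule hol) (use u inP in auto)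
        qed auto
        have "\<forall>k\<in>{..<s}. eventually (\<lambda>t. elim k K u (\<lambda>k. vec_upd (y + t *s (b - y)) i (x k)) (u k)
            (vec_upd (y + t *s (b - y)) i (x k)) \<noteq> 0) (nhds 0)"
        proof
          fix k assume k: "k \<in> {..<s}"
          have "isCont (\<lambda>t. elim k K u (\<lambda>k. vec_upd (y + t *s (b - y)) i (x k)) (u k)
            (vec_upd (y + t *s (b - y)) i (x k))) 0"
            using holomorphic_on_imp_continuous_on[OF hol'] R by (simp add: continuous_on_eq_continuous_at)
          then have "eventually (\<lambda>t. elim k K u (\<lambda>k. vec_upd (y + t *s (b - y)) i (x k)) (u k)
            (vec_upd (y + t *s (b - y)) i (x k)) \<noteq> 0) (at 0)"
            unfolding isCont_def by (rule tendsto_imp_eventually_ne) (use piv k in \<open>auto simp: pivots_def\<close>)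
          then show "eventually (\<lambda>t. elim k K u (\<lambda>k. vec_upd (y + t *s (b - y)) i (x k)) (u k)
            (vec_upd (y + t *s (b - y)) i (x k)) \<noteq> 0) (nhds 0)"
            by (simp add: eventually_nhds_conv_at) (use piv k in \<open>auto simp: pivots_def\<close>)
        qed
        then have "eventually (\<lambda>t. pivots s u x (y + t *s (b - y))) (nhds 0)"
          by (subst (asm) eventually_ball_finite_distrib[symmetric]) (auto simp: pivots_def elim: eventually_mono)
        moreover have "eventually (\<lambda>t. t \<in> R) (nhds 0)"
          using R by (auto simp: eventually_nhds)
        ultimately show "eventually (\<lambda>t. y + t *s (b - y) \<in> B') (nhds 0)"
          by eventually_elim (use y \<open>b \<in> B\<close> in \<open>auto simp: B'_def B_def slice_def R_def\<close>)
      qed (use B_P hol in \<open>auto simp: open_polydisc convex_polydisc\<close>)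
      then show ?thesis
        unfolding B_def by (rule kernel_rank_le_mono) (use insert s in \<open>auto simp: N_def\<close>)
    qed
  qed
  show ?thesis
  proof (cases "?P = {}")
    case True
    then show ?thesis by (auto simp: kernel_rank_le_def)
  next
    case False
    then obtain p where "p \<in> ?P" by blast
    then show ?thesis
      using slices[of UNIV p] by (simp add: slice_def)
  qed
qed

section \<open>Complexified power series\<close>

definition kernel_series ::
  "(nat ^ 'k \<Rightarrow> nat ^ 'k \<Rightarrow> complex) \<Rightarrow> complex ^ 'k \<Rightarrow> complex ^ 'k \<Rightarrow> complex" where
  "kernel_series c z w = (\<Sum>\<^sub>\<infinity>(\<alpha>, \<beta>). c \<alpha> \<beta> * monomial z \<alpha> * monomial w \<beta>)"

lemma norm_monomial: "cmod (monomial z \<alpha>) = (\<Prod>i\<in>UNIV. cmod (z $ i) ^ (\<alpha> $ i))"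
  by (simp add: monomial_def prod_norm norm_power flip: prod_norm)

lemma norm_monomial_mono:
  "(\<And>i. cmod (z $ i) \<le> cmod (\<rho> $ i)) \<Longrightarrow> cmod (monomial z \<alpha>) \<le> cmod (monomial \<rho> \<alpha>)"
  unfolding norm_monomial by (intro prod_mono) (auto intro!: power_mono)

lemma kernel_series_term_le:
  assumes "\<And>i. cmod (z $ i) \<le> cmod (\<rho> $ i)" "\<And>i. cmod (w $ i) \<le> cmod (\<sigma> $ i)"
  shows "cmod (c * monomial z \<alpha> * monomial w \<beta>) \<le> cmod (c * monomial \<rho> \<alpha> * monomial \<sigma> \<beta>)"
  by (simp only: norm_mult)
     (intro mult_mono norm_monomial_mono assms order_refl mult_nonneg_nonneg norm_ge_zero)

lemma kernel_series_summable_mono: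
  assumes "(\<lambda>(\<alpha>, \<beta>). c \<alpha> \<beta> * monomial \<rho> \<alpha> * monomial \<sigma> \<beta>) summable_on UNIV"
    and "\<And>i. cmod (z $ i) \<le> cmod (\<rho> $ i)" "\<And>i. cmod (w $ i) \<le> cmod (\<sigma> $ i)"
  shows "(\<lambda>(\<alpha>, \<beta>). c \<alpha> \<beta> * monomial z \<alpha> * monomial w \<beta>) summable_on UNIV"
proof (rule Infinite_Sum.abs_summable_summable, rule Infinite_Sum.abs_summable_on_comparison_test)
  show "(\<lambda>x. cmod (case x of (\<alpha>, \<beta>) \<Rightarrow> c \<alpha> \<beta> * monomial \<rho> \<alpha> * monomial \<sigma> \<beta>)) summable_on UNIV"
    using assms(1) by (simp add: summable_on_iff_abs_summable_on_complex)
qed (use kernel_series_term_le[OF assms(2,3)] in auto)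

text \<open>Convergence at the single point (\<rho>, \<sigma>) is absolute and majorizes the terms
  on the polydiscs with these radii, so the partial sums converge uniformly on a small disc of the
  line.\<close>

lemma gateaux_holomorphic_kernel_series:
  assumes summ: "(\<lambda>(\<alpha>, \<beta>). c \<alpha> \<beta> * monomial \<rho> \<alpha> * monomial \<sigma> \<beta>) summable_on UNIV"
  shows "gateaux_holomorphic (kernel_series c)
    {z. \<forall>i. cmod (z $ i) < cmod (\<rho> $ i)} {w. \<forall>i. cmod (w $ i) < cmod (\<sigma> $ i)}"
  unfolding gateaux_holomorphic_def
proof (intro ballI allI)
  fix z w u v :: "complex ^ 'a"
  assume z: "z \<in> {z. \<forall>i. cmod (z $ i) < cmod (\<rho> $ i)}" and w: "w \<in> {w. \<forall>i. cmod (w $ i) < cmod (\<sigma> $ i)}"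
  have op: "open {z. \<forall>i. cmod (z $ i) < cmod (\<rho> $ i)}" for \<rho> :: "complex ^ 'a"
    unfolding Collect_all_eq by (intro open_INT ballI open_Collect_less continuous_intros) auto
  define S where "S = {t. z + t *s u \<in> {z. \<forall>i. cmod (z $ i) < cmod (\<rho> $ i)}} \<inter>
    {t. w + t *s v \<in> {z. \<forall>i. cmod (z $ i) < cmod (\<sigma> $ i)}}"
  have "open S"
    unfolding S_def by (intro open_Int open_line_preimage op)
  moreover have "0 \<in> S"
    using z w by (simp add: S_def)
  ultimately obtain r where r: "r > 0" "cball 0 r \<subseteq> S"
    using open_contains_cball by blast
  define f where "f t = (\<lambda>(\<alpha>, \<beta>). c \<alpha> \<beta> * monomial (z + t *s u) \<alpha> * monomial (w + t *s v) \<beta>)" for t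
  have hol: "(\<lambda>t. \<Sum>x\<in>X. f t x) holomorphic_on T" for X T
    unfolding f_def monomial_def case_prod_unfold by (simp, intro holomorphic_intros)
  have ul: "uniform_limit (cball 0 r) (\<lambda>X t. \<Sum>x\<in>X. f t x) (\<lambda>t. \<Sum>\<^sub>\<infinity>x\<in>UNIV. f t x)
      (finite_subsets_at_top UNIV)"
  proof (rule Weierstrass_m_test_general)
    show "(\<lambda>x. cmod (case x of (\<alpha>, \<beta>) \<Rightarrow> c \<alpha> \<beta> * monomial \<rho> \<alpha> * monomial \<sigma> \<beta>)) summable_on UNIV"
      using summ by (simp add: summable_on_iff_abs_summable_on_complex)
    fix x t assume "t \<in> cball (0 :: complex) r"
    then have "t \<in> S" using r by blast
    then show "cmod (f t x) \<le> cmod (case x of (\<alpha>, \<beta>) \<Rightarrow> c \<alpha> \<beta> * monomial \<rho> \<alpha> * monomial \<sigma> \<beta>)"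
      unfolding f_def case_prod_unfold by (intro kernel_series_term_le) (auto simp: S_def less_imp_le)
  qed
  have "(\<lambda>t. \<Sum>\<^sub>\<infinity>x\<in>UNIV. f t x) holomorphic_on ball 0 r"
    by (rule holomorphic_uniform_limit[OF _ ul])
       (auto intro!: always_eventually holomorphic_on_imp_continuous_on hol)
  then have "(\<lambda>t. \<Sum>\<^sub>\<infinity>x\<in>UNIV. f t x) field_differentiable at 0"
    using r by (intro holomorphic_on_imp_differentiable_at) auto
  then show "(\<lambda>t. kernel_series c (z + t *s u) (w + t *s v)) field_differentiable at 0"
    by (simp add: kernel_series_def f_def)
qed

text \<open>Supplies the majorizing point: every coordinate is stretched a little, and a zero
  coordinate, which stretching would not change, is moved in direction 1.\<close>

lemma ex_inflated_point:
  fixes z :: "complex ^ 'k"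
  assumes "open U" "z \<in> U"
  obtains \<rho> where "\<rho> \<in> U" "\<And>i. cmod (z $ i) < cmod (\<rho> $ i)"
proof -
  define u :: "complex ^ 'k" where "u = (\<chi> i. if z $ i = 0 then 1 else z $ i)"
  have "eventually (\<lambda>t. z + t *s u \<in> U) (nhds 0)"
    using assms by (rule eventually_nhds_line)
  then obtain e where e: "e > 0" "\<And>t. dist t 0 < e \<Longrightarrow> z + t *s u \<in> U"
    by (auto simp: eventually_nhds_metric)
  define \<rho> where "\<rho> = z + of_real (e / 2) *s u"
  have "\<rho> \<in> U"
    unfolding \<rho>_def using e(1) by (intro e(2)) auto
  moreover have "cmod (z $ i) < cmod (\<rho> $ i)" for i
  proof (cases "z $ i = 0")
    case True
    then show ?thesis using e(1) by (simp add: \<rho>_def u_def)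
  next
    case False
    then have "\<rho> $ i = of_real (1 + e / 2) * z $ i"
      by (simp add: \<rho>_def u_def algebra_simps)
    then have "cmod (\<rho> $ i) = (1 + e / 2) * cmod (z $ i)"
      using e(1) by (simp add: norm_mult del: of_real_add)
    then show ?thesis using e(1) False by (simp add: algebra_simps)
  qed
  ultimately show ?thesis
    using that by blast
qed

lemma gateaux_holomorphic_kernel_series_open:
  assumes "open A" "open B" "series_converges_on c (A \<times> B)"
  shows "gateaux_holomorphic (kernel_series c) A B"
  unfolding gateaux_holomorphic_def
proof (intro ballI allI)
  fix z w u v assume "z \<in> A" "w \<in> B"
  obtain \<rho> where \<rho>: "\<rho> \<in> A" "\<And>i. cmod (z $ i) < cmod (\<rho> $ i)"
    using ex_inflated_point[OF assms(1) \<open>z \<in> A\<close>] by blast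
  obtain \<sigma> where \<sigma>: "\<sigma> \<in> B" "\<And>i. cmod (w $ i) < cmod (\<sigma> $ i)"
    using ex_inflated_point[OF assms(2) \<open>w \<in> B\<close>] by blast
  have "(\<lambda>(\<alpha>, \<beta>). c \<alpha> \<beta> * monomial \<rho> \<alpha> * monomial \<sigma> \<beta>) summable_on UNIV"
    using assms(3) \<rho>(1) \<sigma>(1) by (auto simp: series_converges_on_def)
  from gateaux_holomorphic_kernel_series[OF this]
  show "(\<lambda>t. kernel_series c (z + t *s u) (w + t *s v)) field_differentiable at 0"
    using \<rho>(2) \<sigma>(2) by (simp add: gateaux_holomorphic_def)
qed

section \<open>Uniqueness of power series coefficients\<close>

lemma powser_eq_0:
  fixes b :: "nat \<Rightarrow> complex"
  assumes "r > 0" "\<And>x. cmod x < r \<Longrightarrow> (\<lambda>n. b n * x ^ n) sums 0"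
  shows "b n = 0"
proof (rule ccontr)
  assume nz: "b n \<noteq> 0"
  have "b 0 = 0"
    using assms(2)[of 0] assms(1) by simp
  then have "n > 0"
    using nz by (cases n) auto
  \<comment> \<open>Isolation of zeros, applied to the zero function, is absurd. It asks for a
    nonzero coefficient of positive index, which is why \<open>b 0\<close> was settled
    beforehand.\<close>
  obtain s where "0 < s" "\<And>z :: complex. z \<in> cball 0 s - {0} \<Longrightarrow> (0 :: complex) \<noteq> 0"
    by (rule powser_0_nonzero[of r 0 b "\<lambda>_. 0" n]) (use assms nz \<open>n > 0\<close> in auto)
  from this(2)[of "of_real s"] \<open>0 < s\<close> show False by simp
qed

text \<open>The exponents are fixed one coordinate at a time: varying a single coordinate gives a
  power series in one variable whose coefficients are the sums over the fibres. When all are fixed,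
  only the exponent \<alpha> is left.\<close>

lemma power_series_eq_0:
  fixes a :: "nat ^ 'k \<Rightarrow> complex"
  assumes "r > 0" and 0: "\<And>z. z \<in> polydisc r \<Longrightarrow> ((\<lambda>\<alpha>. a \<alpha> * monomial z \<alpha>) has_sum 0) UNIV"
  shows "a \<alpha> = 0"
proof -
  let ?m = "\<lambda>S z (\<gamma> :: nat ^ 'k). \<Prod>i\<in>-S. (z $ i :: complex) ^ (\<gamma> $ i)"
  have "((\<lambda>\<gamma>. a \<gamma> * ?m S z \<gamma>) has_sum 0) {\<gamma>. \<forall>i\<in>S. \<gamma> $ i = \<alpha> $ i}"
    if "finite S" "z \<in> polydisc r" for S z
    using that
  proof (induction S arbitrary: z \<alpha>)
    case empty
    then show ?case using 0[of z] by (simp add: monomial_def)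
  next
    case (insert i S)
    define X where "X = {\<gamma> :: nat ^ 'k. \<forall>j\<in>S. \<gamma> $ j = \<alpha> $ j}"
    define X' where "X' n = {\<gamma>\<in>X. \<gamma> $ i = n}" for n
    define g where "g \<gamma> = a \<gamma> * ?m (insert i S) z \<gamma>" for \<gamma>
    have compl: "-S = insert i (- insert i S)" "finite (- insert i S)"
      using insert.hyps by auto
    have sum_x: "((\<lambda>\<gamma>. g \<gamma> * x ^ (\<gamma> $ i)) has_sum 0) X" if "cmod x < r" for x
    proof -
      have "vec_upd z i x \<in> polydisc r"
        using insert.prems that by (auto simp: polydisc_def vec_upd_nth)
      note insert.IH[OF this, of \<alpha>]
      moreover have "a \<gamma> * ?m S (vec_upd z i x) \<gamma> = g \<gamma> * x ^ (\<gamma> $ i)" for \<gamma>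
      proof -
        have "?m S (vec_upd z i x) \<gamma> = x ^ (\<gamma> $ i) * (\<Prod>j\<in>- insert i S. (vec_upd z i x $ j) ^ (\<gamma> $ j))"
          unfolding compl(1) using compl(2) by (subst prod.insert) (auto simp: vec_upd_nth)
        also have "(\<Prod>j\<in>- insert i S. (vec_upd z i x $ j) ^ (\<gamma> $ j)) = ?m (insert i S) z \<gamma>"
          by (rule prod.cong) (auto simp: vec_upd_nth)
        finally show ?thesis by (simp add: g_def)
      qed
      ultimately show ?thesis by (simp add: X_def)
    qed
    \<comment> \<open>At the point \<open>r/2\<close> the extra power is a nonzero constant on
      \<open>X' n\<close> and can be divided out.\<close>
    have summ: "g summable_on X' n" for n
    proof -
      have "(\<lambda>\<gamma>. g \<gamma> * of_real (r/2) ^ (\<gamma> $ i)) summable_on X"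
        using has_sum_imp_summable[OF sum_x[of "of_real (r/2)"]] \<open>r > 0\<close> by simp
      then have "(\<lambda>\<gamma>. g \<gamma> * of_real (r/2) ^ (\<gamma> $ i)) summable_on X' n"
        by (rule summable_on_subset_banach) (auto simp: X'_def)
      moreover have "(\<lambda>\<gamma>. g \<gamma> * of_real (r/2) ^ (\<gamma> $ i)) summable_on X' n \<longleftrightarrow>
          (\<lambda>\<gamma>. g \<gamma> * of_real (r/2) ^ n) summable_on X' n"
        by (rule summable_on_cong) (auto simp: X'_def)
      ultimately show ?thesis
        using \<open>r > 0\<close> by (simp add: summable_on_cmult_left')
    qed
    have "(\<lambda>n. infsum g (X' n) * x ^ n) sums 0" if "cmod x < r" for x
    proof (rule has_sum_imp_sums, rule has_sum_SigmaD)
      have "bij_betw snd (Sigma UNIV X') X"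
        by (rule bij_betwI[of _ _ _ "\<lambda>\<gamma>. (\<gamma> $ i, \<gamma>)"]) (auto simp: X'_def)
      from has_sum_reindex_bij_betw[OF this, of "\<lambda>\<gamma>. g \<gamma> * x ^ (\<gamma> $ i)" 0] sum_x[OF that]
      show "((\<lambda>y. g (snd y) * x ^ (snd y $ i)) has_sum 0) (Sigma UNIV X')" by simp
      show "((\<lambda>\<gamma>. g (snd (n, \<gamma>)) * x ^ (snd (n, \<gamma>) $ i)) has_sum infsum g (X' n) * x ^ n) (X' n)" for n
      proof -
        have "((\<lambda>\<gamma>. g \<gamma> * x ^ n) has_sum infsum g (X' n) * x ^ n) (X' n)"
          by (intro has_sum_cmult_left has_sum_infsum summ)
        then show ?thesis
          by (rule has_sum_cong[THEN iffD1, rotated]) (auto simp: X'_def)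
      qed
    qed
    then have "infsum g (X' (\<alpha> $ i)) = 0"
      using \<open>r > 0\<close> by (rule powser_eq_0[rotated])
    then have "(g has_sum 0) (X' (\<alpha> $ i))"
      using summ by (simp add: has_sum_iff)
    moreover have "X' (\<alpha> $ i) = {\<gamma>. \<forall>j\<in>insert i S. \<gamma> $ j = \<alpha> $ j}"
      by (auto simp: X'_def X_def)
    ultimately show ?case
      by (simp only: g_def[abs_def])
  qed
  from this[of UNIV 0] \<open>r > 0\<close>
  have "((\<lambda>\<gamma>. a \<gamma>) has_sum 0) {\<gamma>. \<forall>i. \<gamma> $ i = \<alpha> $ i}"
    by (simp add: polydisc_def)
  moreover have "{\<gamma>. \<forall>i. \<gamma> $ i = \<alpha> $ i} = {\<alpha>}"
    by (auto simp: vec_eq_iff)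
  ultimately show ?thesis
    using has_sum_unique[of a "{\<alpha>}" 0 "a \<alpha>"] by (simp add: has_sum_finiteI)
qed

lemma sum_fun_pointwise: "(\<Sum>j\<in>J. f j) x = (\<Sum>j\<in>J. f j x :: complex)"
  by (induction J rule: infinite_finite_induct) auto

lemma has_sum_sum:
  fixes f :: "'j \<Rightarrow> 'a \<Rightarrow> complex"
  assumes "\<And>j. j \<in> J \<Longrightarrow> (f j has_sum s j) A"
  shows "((\<lambda>x. \<Sum>j\<in>J. f j x) has_sum (\<Sum>j\<in>J. s j)) A"
  using assms by (induction J rule: infinite_finite_induct) (auto intro!: has_sum_add)

lemma has_sum_diff:
  fixes f g :: "'a \<Rightarrow> complex"
  assumes "(f has_sum a) A" "(g has_sum b) A"
  shows "((\<lambda>x. f x - g x) has_sum (a - b)) A"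
  using has_sum_add[OF assms(1) has_sum_uminusI[OF assms(2)]] by simp

lemma kernel_rank_leI_lessThan:
  "s \<le> N \<Longrightarrow> (\<And>a b. a \<in> A \<Longrightarrow> b \<in> B \<Longrightarrow> K a b = (\<Sum>k<s. g k a * h k b)) \<Longrightarrow> kernel_rank_le K A B N"
  by (rule kernel_rank_leI[of "{..<s}"]) simp_all

lemma kernel_rank_le_skeleton_rows:
  assumes "kernel_rank_le K A B N"
  shows "\<exists>s\<le>N. \<exists>p c. (\<forall>k<s. p k \<in> A) \<and> (\<forall>a\<in>A. \<forall>b\<in>B. K a b = (\<Sum>k<s. c k a * K (p k) b))"
  using kernel_rank_le_skeleton[OF kernel_rank_le_transpose[OF assms]]
  by (subst mult.commute) blast

section \<open>Kernel, coefficient matrix and operator\<close>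

context
  fixes c :: "nat ^ 'k \<Rightarrow> nat ^ 'k \<Rightarrow> complex"
  assumes summ: "(\<lambda>(\<alpha>, \<beta>). c \<alpha> \<beta>) summable_on UNIV"
begin

lemma summable_row: "(\<lambda>\<beta>. c \<alpha> \<beta>) summable_on UNIV"
  using summable_on_SigmaD1[of c UNIV "\<lambda>_. UNIV" \<alpha>] summ by simp

lemma kernel_series_summable_polydisc:
  assumes "z \<in> polydisc 1" "w \<in> polydisc 1"
  shows "(\<lambda>(\<alpha>, \<beta>). c \<alpha> \<beta> * monomial z \<alpha> * monomial w \<beta>) summable_on UNIV"
  by (rule kernel_series_summable_mono[of _ "\<chi> i. 1" "\<chi> i. 1"])
     (use assms summ in \<open>auto simp: polydisc_def monomial_def less_imp_le\<close>)

lemma row_series_summable: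
  assumes "w \<in> polydisc 1"
  shows "(\<lambda>\<beta>. c \<alpha> \<beta> * monomial w \<beta>) summable_on UNIV"
proof (rule Infinite_Sum.abs_summable_summable, rule Infinite_Sum.abs_summable_on_comparison_test)
  show "(\<lambda>\<beta>. cmod (c \<alpha> \<beta>)) summable_on UNIV"
    using summable_row by (simp add: summable_on_iff_abs_summable_on_complex)
  have "cmod (monomial w \<beta>) \<le> 1" for \<beta>
    using norm_monomial_mono[of w "\<chi> i. 1" \<beta>] assms
    by (simp add: polydisc_def less_imp_le) (simp add: monomial_def)
  then show "cmod (c \<alpha> \<beta> * monomial w \<beta>) \<le> cmod (c \<alpha> \<beta>)" for \<beta>
    by (simp add: norm_mult mult_left_le)
qed

lemma kernel_series_has_sum_rows:
  assumes "z \<in> polydisc 1" "w \<in> polydisc 1"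
  shows "((\<lambda>\<alpha>. (\<Sum>\<^sub>\<infinity>\<beta>. c \<alpha> \<beta> * monomial w \<beta>) * monomial z \<alpha>) has_sum kernel_series c z w) UNIV"
proof (rule has_sum_SigmaD[where B = "\<lambda>_. UNIV"])
  show "((\<lambda>(\<alpha>, \<beta>). c \<alpha> \<beta> * monomial z \<alpha> * monomial w \<beta>) has_sum kernel_series c z w) (UNIV \<times> UNIV)"
    using kernel_series_summable_polydisc[OF assms] by (simp add: kernel_series_def)
  fix \<alpha>
  have "((\<lambda>\<beta>. c \<alpha> \<beta> * monomial w \<beta> * monomial z \<alpha>) has_sum
      (\<Sum>\<^sub>\<infinity>\<beta>. c \<alpha> \<beta> * monomial w \<beta>) * monomial z \<alpha>) UNIV"
    by (intro has_sum_cmult_left has_sum_infsum row_series_summable assms)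
  then show "((\<lambda>\<beta>. case (\<alpha>, \<beta>) of (\<alpha>, \<beta>) \<Rightarrow> c \<alpha> \<beta> * monomial z \<alpha> * monomial w \<beta>) has_sum
      (\<Sum>\<^sub>\<infinity>\<beta>. c \<alpha> \<beta> * monomial w \<beta>) * monomial z \<alpha>) UNIV"
    by (simp add: mult_ac)
qed

text \<open>Both directions pass through \<open>R\<close>, which is expanded in the first variable
  and evaluated in the second, so that only one variable changes at a time. Skeletons provide
  factors over which the series can be summed. Since \<epsilon> is arbitrary, the rank of the matrix
  can be read off near the origin.\<close>

lemma kernel_rank_le_coefficients:
  assumes "0 < \<epsilon>" "\<epsilon> \<le> 1"
  shows "kernel_rank_le (kernel_series c) (polydisc \<epsilon>) (polydisc \<epsilon>) N \<longleftrightarrow>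
    kernel_rank_le c UNIV UNIV N"
proof
  define R where "R \<alpha> w = (\<Sum>\<^sub>\<infinity>\<beta>. c \<alpha> \<beta> * monomial w \<beta>)" for \<alpha> w
  have \<epsilon>1: "polydisc \<epsilon> \<subseteq> polydisc 1"
    using assms by (auto simp: polydisc_def intro: less_le_trans)
  have R: "((\<lambda>\<beta>. c \<alpha> \<beta> * monomial w \<beta>) has_sum R \<alpha> w) UNIV" if "w \<in> polydisc \<epsilon>" for \<alpha> w
    unfolding R_def using that \<epsilon>1 by (intro has_sum_infsum row_series_summable) auto
  have K: "((\<lambda>\<alpha>. R \<alpha> w * monomial z \<alpha>) has_sum kernel_series c z w) UNIV"
    if "z \<in> polydisc \<epsilon>" "w \<in> polydisc \<epsilon>" for z w
    unfolding R_def using that \<epsilon>1 by (intro kernel_series_has_sum_rows) auto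
  {
    assume "kernel_rank_le c UNIV UNIV N"
    then obtain s p e where s: "s \<le> N"
      and e': "\<forall>\<alpha>\<in>UNIV. \<forall>\<beta>\<in>UNIV. c \<alpha> \<beta> = (\<Sum>k<s. e k \<alpha> * c (p k) \<beta>)"
      using kernel_rank_le_skeleton_rows by blast
    note e = e'[rule_format, OF UNIV_I UNIV_I]
    have eq: "R \<alpha> w = (\<Sum>k<s. e k \<alpha> * R (p k) w)" if "w \<in> polydisc \<epsilon>" for \<alpha> w
    proof (rule has_sum_unique[OF R[OF that]])
      have "((\<lambda>\<beta>. \<Sum>k<s. e k \<alpha> * (c (p k) \<beta> * monomial w \<beta>)) has_sum (\<Sum>k<s. e k \<alpha> * R (p k) w)) UNIV"
        by (intro has_sum_sum has_sum_cmult_right R that)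
      then show "((\<lambda>\<beta>. c \<alpha> \<beta> * monomial w \<beta>) has_sum (\<Sum>k<s. e k \<alpha> * R (p k) w)) UNIV"
        by (simp add: e[of \<alpha>] sum_distrib_right mult.assoc)
    qed
    have "kernel_rank_le R UNIV (polydisc \<epsilon>) N"
      by (rule kernel_rank_leI_lessThan[OF s]) (rule eq; assumption)
    \<comment> \<open>The skeleton now consists of columns instead of rows: the next summation runs
      over \<alpha> and needs factors that are summable in \<alpha>.\<close>
    then obtain s q d where s: "s \<le> N" and q: "\<forall>k<s. q k \<in> polydisc \<epsilon>"
      and d': "\<forall>\<alpha>\<in>UNIV. \<forall>w\<in>polydisc \<epsilon>. R \<alpha> w = (\<Sum>k<s. R \<alpha> (q k) * d k w)"
      using kernel_rank_le_skeleton by blast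
    note q = q[rule_format] and d = d'[rule_format, OF UNIV_I]
    have eq: "kernel_series c z w = (\<Sum>k<s. kernel_series c z (q k) * d k w)"
      if "z \<in> polydisc \<epsilon>" "w \<in> polydisc \<epsilon>" for z w
    proof (rule has_sum_unique[OF K[OF that]])
      have "((\<lambda>\<alpha>. \<Sum>k<s. R \<alpha> (q k) * monomial z \<alpha> * d k w) has_sum
          (\<Sum>k<s. kernel_series c z (q k) * d k w)) UNIV"
        by (intro has_sum_sum has_sum_cmult_left K that q) auto
      moreover have "R \<alpha> w * monomial z \<alpha> = (\<Sum>k<s. R \<alpha> (q k) * monomial z \<alpha> * d k w)" for \<alpha>
        by (subst d[OF that(2)], subst sum_distrib_right) (rule sum.cong; simp)
      ultimately show "((\<lambda>\<alpha>. R \<alpha> w * monomial z \<alpha>) has_sum (\<Sum>k<s. kernel_series c z (q k) * d k w)) UNIV"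
        by (simp only:)
    qed
    show "kernel_rank_le (kernel_series c) (polydisc \<epsilon>) (polydisc \<epsilon>) N"
      by (rule kernel_rank_leI_lessThan[OF s]) (rule eq; assumption)
  }
  {
    assume "kernel_rank_le (kernel_series c) (polydisc \<epsilon>) (polydisc \<epsilon>) N"
    then obtain s q d where s: "s \<le> N" and q: "\<forall>k<s. q k \<in> polydisc \<epsilon>"
      and d: "\<forall>z\<in>polydisc \<epsilon>. \<forall>w\<in>polydisc \<epsilon>.
        kernel_series c z w = (\<Sum>k<s. kernel_series c z (q k) * d k w)"
      using kernel_rank_le_skeleton by blast
    note q = q[rule_format] and d = d[rule_format]
    \<comment> \<open>For fixed \<open>w\<close> both sides are coefficients of power series in
      \<open>z\<close> with equal sums.\<close>
    have eq: "R \<alpha> w = (\<Sum>k<s. R \<alpha> (q k) * d k w)" if w: "w \<in> polydisc \<epsilon>" for \<alpha> w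
    proof -
      have "((\<lambda>\<alpha>. (R \<alpha> w - (\<Sum>k<s. R \<alpha> (q k) * d k w)) * monomial z \<alpha>) has_sum 0) UNIV"
        if z: "z \<in> polydisc \<epsilon>" for z
      proof -
        have "((\<lambda>\<alpha>. R \<alpha> w * monomial z \<alpha> - (\<Sum>k<s. R \<alpha> (q k) * monomial z \<alpha> * d k w)) has_sum
            (kernel_series c z w - (\<Sum>k<s. kernel_series c z (q k) * d k w))) UNIV"
          by (intro has_sum_diff has_sum_sum has_sum_cmult_left K z w q) auto
        moreover have "kernel_series c z w - (\<Sum>k<s. kernel_series c z (q k) * d k w) = 0"
          using d[OF z w] by simp
        moreover have "(R \<alpha> w - (\<Sum>k<s. R \<alpha> (q k) * d k w)) * monomial z \<alpha> =
            R \<alpha> w * monomial z \<alpha> - (\<Sum>k<s. R \<alpha> (q k) * monomial z \<alpha> * d k w)" for \<alpha>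
          unfolding left_diff_distrib sum_distrib_right by (simp only: mult_ac)
        ultimately show ?thesis
          by (simp only:)
      qed
      from power_series_eq_0[OF assms(1) this, of \<alpha>] show ?thesis by simp
    qed
    have "kernel_rank_le R UNIV (polydisc \<epsilon>) N"
      by (rule kernel_rank_leI_lessThan[OF s]) (rule eq; assumption)
    then obtain s p e where s: "s \<le> N"
      and e': "\<forall>\<alpha>\<in>UNIV. \<forall>w\<in>polydisc \<epsilon>. R \<alpha> w = (\<Sum>k<s. e k \<alpha> * R (p k) w)"
      using kernel_rank_le_skeleton_rows by blast
    note e = e'[rule_format, OF UNIV_I]
    have eq: "c \<alpha> \<beta> = (\<Sum>k<s. e k \<alpha> * c (p k) \<beta>)" for \<alpha> \<beta>
    proof -
      have "((\<lambda>\<beta>. (c \<alpha> \<beta> - (\<Sum>k<s. e k \<alpha> * c (p k) \<beta>)) * monomial w \<beta>) has_sum 0) UNIV"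
        if w: "w \<in> polydisc \<epsilon>" for w
      proof -
        have "((\<lambda>\<beta>. c \<alpha> \<beta> * monomial w \<beta> - (\<Sum>k<s. e k \<alpha> * (c (p k) \<beta> * monomial w \<beta>))) has_sum
            (R \<alpha> w - (\<Sum>k<s. e k \<alpha> * R (p k) w))) UNIV"
          by (intro has_sum_diff has_sum_sum has_sum_cmult_right R w)
        moreover have "R \<alpha> w - (\<Sum>k<s. e k \<alpha> * R (p k) w) = 0"
          using e[OF w, of \<alpha>] by simp
        ultimately show ?thesis
          by (simp add: left_diff_distrib sum_distrib_right mult.assoc)
      qed
      from power_series_eq_0[OF assms(1) this, of \<beta>] show ?thesis by simp
    qed
    show "kernel_rank_le c UNIV UNIV N"
      by (rule kernel_rank_leI_lessThan[OF s]) (rule eq; assumption)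
  }
qed

text \<open>A row skeleton writes \<open>matrix_apply c x\<close> as a combination of the
  \<open>e k\<close>. Conversely the unit vectors belong to \<open>ell2\<close>, so the columns of
  \<open>c\<close> lie in the range, and a basis of the range provides the factors.\<close>

lemma operator_rank_le_iff: "operator_rank c \<le> enat N \<longleftrightarrow> kernel_rank_le c UNIV UNIV N"
proof
  define V where "V = matrix_apply c ` ell2"
  assume "kernel_rank_le c UNIV UNIV N"
  then obtain s p e where s: "s \<le> N"
      and e': "\<forall>\<alpha>\<in>UNIV. \<forall>\<beta>\<in>UNIV. c \<alpha> \<beta> = (\<Sum>k<s. e k \<alpha> * c (p k) \<beta>)"
    using kernel_rank_le_skeleton_rows by blast
  note e = e'[rule_format, OF UNIV_I UNIV_I]
  have "matrix_apply c x \<in> cfun.span (e ` {..<s})" if x: "x \<in> ell2" for x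
  proof -
    \<comment> \<open>Square-summable families are bounded, and a bounded family can be paired with
      the absolutely summable rows of \<open>c\<close>.\<close>
    have bound: "cmod (x \<beta>) \<le> 1 + (\<Sum>\<^sub>\<infinity>b. (cmod (x b))\<^sup>2)" for \<beta>
    proof -
      have "(cmod (x \<beta>))\<^sup>2 \<le> (\<Sum>\<^sub>\<infinity>b. (cmod (x b))\<^sup>2)"
        using finite_sum_le_infsum[of "\<lambda>b. (cmod (x b))\<^sup>2" UNIV "{\<beta>}"] x by (simp add: ell2_def)
      moreover have "cmod (x \<beta>) \<le> 1 + (cmod (x \<beta>))\<^sup>2"
        using zero_le_power2[of "cmod (x \<beta>) - 1/2"] by (simp add: power2_eq_square algebra_simps)
      ultimately show ?thesis by simp
    qed
    have cx: "(\<lambda>\<beta>. c \<alpha> \<beta> * x \<beta>) summable_on UNIV" for \<alpha>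
    proof (rule Infinite_Sum.abs_summable_summable, rule Infinite_Sum.abs_summable_on_comparison_test')
      show "(\<lambda>\<beta>. cmod (c \<alpha> \<beta>) * (1 + (\<Sum>\<^sub>\<infinity>b. (cmod (x b))\<^sup>2))) summable_on UNIV"
        using summable_row[of \<alpha>]
        by (intro summable_on_cmult_left) (simp add: summable_on_iff_abs_summable_on_complex)
      show "cmod (c \<alpha> \<beta> * x \<beta>) \<le> cmod (c \<alpha> \<beta>) * (1 + (\<Sum>\<^sub>\<infinity>b. (cmod (x b))\<^sup>2))" for \<beta>
        unfolding norm_mult by (intro mult_left_mono bound) auto
    qed
    have expand: "matrix_apply c x \<alpha> = (\<Sum>k<s. matrix_apply c x (p k) * e k \<alpha>)" for \<alpha>
      unfolding matrix_apply_def
    proof (rule infsumI)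
      have "((\<lambda>\<beta>. \<Sum>k<s. c (p k) \<beta> * x \<beta> * e k \<alpha>) has_sum
          (\<Sum>k<s. (\<Sum>\<^sub>\<infinity>\<beta>. c (p k) \<beta> * x \<beta>) * e k \<alpha>)) UNIV"
        by (intro has_sum_sum has_sum_cmult_left has_sum_infsum cx)
      moreover have "c \<alpha> \<beta> * x \<beta> = (\<Sum>k<s. c (p k) \<beta> * x \<beta> * e k \<alpha>)" for \<beta>
        by (subst e, subst sum_distrib_right) (rule sum.cong; simp)
      ultimately show "((\<lambda>\<beta>. c \<alpha> \<beta> * x \<beta>) has_sum (\<Sum>k<s. (\<Sum>\<^sub>\<infinity>\<beta>. c (p k) \<beta> * x \<beta>) * e k \<alpha>)) UNIV"
        by (simp only:)
    qed
    have "matrix_apply c x = (\<Sum>k<s. (\<lambda>\<alpha>. matrix_apply c x (p k) * e k \<alpha>))"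
      by (rule ext, subst sum_fun_pointwise) (rule expand)
    also have "\<dots> \<in> cfun.span (e ` {..<s})"
      by (intro cfun.span_sum cfun.span_scale cfun.span_base) auto
    finally show ?thesis .
  qed
  then have sub: "V \<subseteq> cfun.span (e ` {..<s})"
    by (auto simp: V_def)
  have "cfun.dim V \<le> card (e ` {..<s})"
    by (rule cfun.dim_le_card[OF sub]) simp
  also have "\<dots> \<le> N"
    using card_image_le[of "{..<s}" e] s by simp
  finally show "operator_rank c \<le> enat N"
    using sub unfolding operator_rank_def V_def by auto
next
  define V where "V = matrix_apply c ` ell2"
  assume le: "operator_rank c \<le> enat N"
  \<comment> \<open>A finite bound rules out the branch \<infinity> of \<open>operator_rank\<close>,
    so \<open>cfun.dim V\<close> is the true dimension and no default value.\<close>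
  then obtain B where B: "finite B" "V \<subseteq> cfun.span B"
    by (auto simp: operator_rank_def V_def split: if_splits)
  then have dim: "cfun.dim V \<le> N"
    using le by (auto simp: operator_rank_def V_def split: if_splits)
  obtain B' where B': "B' \<subseteq> V" "cfun.independent B'" "V \<subseteq> cfun.span B'" "card B' = cfun.dim V"
    by (rule cfun.basis_exists)
  have "finite B'"
    using cfun.independent_span_bound[OF B(1) B'(2)] B'(1) B(2) by auto
  have "(\<lambda>\<alpha>. c \<alpha> \<beta>) \<in> V" for \<beta>
  proof -
    define x :: "nat ^ 'k \<Rightarrow> complex" where "x = (\<lambda>b. if b = \<beta> then 1 else 0)"
    have "x \<in> ell2"
      unfolding ell2_def x_def
      by (auto intro!: finite_nonzero_values_imp_summable_on intro: finite_subset[of _ "{\<beta>}"])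
    moreover have "matrix_apply c x = (\<lambda>\<alpha>. c \<alpha> \<beta>)"
    proof
      fix \<alpha>
      have "(\<Sum>\<^sub>\<infinity>b. c \<alpha> b * x b) = (\<Sum>\<^sub>\<infinity>b\<in>{\<beta>}. c \<alpha> b * x b)"
        by (rule infsum_cong_neutral) (auto simp: x_def)
      then show "matrix_apply c x \<alpha> = c \<alpha> \<beta>"
        by (simp add: matrix_apply_def x_def)
    qed
    ultimately show ?thesis
      unfolding V_def by (metis image_eqI)
  qed
  then have "(\<lambda>\<alpha>. c \<alpha> \<beta>) \<in> range (\<lambda>u. \<Sum>v\<in>B'. (\<lambda>\<alpha>. u v * v \<alpha>))" for \<beta>
    unfolding cfun.span_finite[OF \<open>finite B'\<close>, symmetric] using B'(3) by (rule subsetD[rotated])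
  then have "\<forall>\<beta>. \<exists>u. (\<lambda>\<alpha>. c \<alpha> \<beta>) = (\<Sum>v\<in>B'. (\<lambda>\<alpha>. u v * v \<alpha>))"
    unfolding image_iff by (intro allI) (rule bexE, assumption, rule exI, assumption)
  then obtain u where u: "\<forall>\<beta>. (\<lambda>\<alpha>. c \<alpha> \<beta>) = (\<Sum>v\<in>B'. (\<lambda>\<alpha>. u \<beta> v * v \<alpha>))"
    by (rule choice[THEN exE])
  show "kernel_rank_le c UNIV UNIV N"
  proof (rule kernel_rank_leI[OF \<open>finite B'\<close>])
    show "c \<alpha> \<beta> = (\<Sum>v\<in>B'. v \<alpha> * u \<beta> v)" for \<alpha> \<beta>
      using fun_cong[OF u[rule_format, of \<beta>], of \<alpha>] unfolding sum_fun_pointwise by (simp only: mult.commute)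
  qed (use B'(4) dim in simp)
qed

end

section \<open>Substitution of convergent expansions\<close>

text \<open>A pair of multi-indices becomes one element of an additive monoid on which monomials are
  multiplicative, so products of expansions are convolutions.\<close>

definition bimonomial :: "complex ^ 'k \<Rightarrow> complex ^ 'k \<Rightarrow> (nat ^ 'k) \<times> (nat ^ 'k) \<Rightarrow> complex" where
  "bimonomial z w \<gamma> = monomial z (fst \<gamma>) * monomial w (snd \<gamma>)"

lemma bimonomial_add: "bimonomial z w (\<gamma> + \<delta>) = bimonomial z w \<gamma> * bimonomial z w \<delta>"
  by (simp add: bimonomial_def monomial_def power_add prod.distrib mult_ac)

lemma bimonomial_0: "bimonomial z w 0 = 1"
  by (simp add: bimonomial_def monomial_def)

lemma monomial_axis: "monomial z (axis j 1) = z $ j"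
proof -
  have "monomial z (axis j 1) = (\<Prod>i\<in>UNIV. if i = j then z $ j else 1)"
    unfolding monomial_def by (rule prod.cong) (auto simp: axis_def)
  then show ?thesis by simp
qed

lemma monomial_0: "monomial z 0 = 1"
  by (simp add: monomial_def)

lemma bimonomial_axis:
  "bimonomial z w (axis j 1, 0) = z $ j" "bimonomial z w (0, axis j 1) = w $ j"
  by (simp_all add: bimonomial_def monomial_axis monomial_0 del: One_nat_def)

text \<open>This is 2 to the power of the total degree. A radius above 1 is required for convergence
  near the closed unit bi-polydisc.\<close>

definition weight :: "(nat ^ 'k) \<times> (nat ^ 'k) \<Rightarrow> real" where
  "weight \<gamma> = cmod (bimonomial (\<chi> i. 2) (\<chi> i. 2) \<gamma>)"

lemma weight_add: "weight (\<gamma> + \<delta>) = weight \<gamma> * weight \<delta>"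
  by (simp add: weight_def bimonomial_add norm_mult)

lemma weight_0: "weight 0 = 1"
  by (simp add: weight_def bimonomial_0)

lemma weight_axis: "weight (axis j 1, 0) = 2" "weight (0, axis j 1) = 2"
  by (simp_all add: weight_def bimonomial_axis del: One_nat_def)

lemma weight_pos: "weight \<gamma> > 0"
  by (simp add: weight_def bimonomial_def monomial_def)

lemma weight_nonneg: "weight \<gamma> \<ge> 0"
  using weight_pos[of \<gamma>] by simp

lemma norm_bimonomial_le:
  "(\<And>i. cmod (z $ i) \<le> 2) \<Longrightarrow> (\<And>i. cmod (w $ i) \<le> 2) \<Longrightarrow> cmod (bimonomial z w \<gamma>) \<le> weight \<gamma>"
  unfolding weight_def bimonomial_def norm_mult
  by (intro mult_mono norm_monomial_mono) auto

definition has_expansion ::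
  "(complex ^ 'k \<Rightarrow> complex ^ 'k \<Rightarrow> complex) \<Rightarrow> ((nat ^ 'k) \<times> (nat ^ 'k) \<Rightarrow> complex) \<Rightarrow> bool" where
  "has_expansion F c \<longleftrightarrow> (\<lambda>\<gamma>. cmod (c \<gamma>) * weight \<gamma>) summable_on UNIV \<and>
     (\<forall>z w. (\<forall>i. cmod (z $ i) \<le> 2) \<longrightarrow> (\<forall>i. cmod (w $ i) \<le> 2) \<longrightarrow>
        ((\<lambda>\<gamma>. c \<gamma> * bimonomial z w \<gamma>) has_sum F z w) UNIV)"

text \<open>These weighted \<open>\<ell>\<^sup>1\<close>-norms are submultiplicative, so expansions may be substituted into each
  other. This re-expands a power series at another point and along an affine subspace.\<close>

definition expansion_norm_le :: "(complex ^ 'k \<Rightarrow> complex ^ 'k \<Rightarrow> complex) \<Rightarrow> real \<Rightarrow> bool" where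
  "expansion_norm_le F B \<longleftrightarrow> (\<exists>c. has_expansion F c \<and> (\<Sum>\<^sub>\<infinity>\<gamma>. cmod (c \<gamma>) * weight \<gamma>) \<le> B)"

lemma has_expansionD:
  assumes "has_expansion F c"
  shows "(\<lambda>\<gamma>. cmod (c \<gamma>) * weight \<gamma>) summable_on UNIV"
    and "(\<And>i. cmod (z $ i) \<le> 2) \<Longrightarrow> (\<And>i. cmod (w $ i) \<le> 2) \<Longrightarrow>
        ((\<lambda>\<gamma>. c \<gamma> * bimonomial z w \<gamma>) has_sum F z w) UNIV"
  using assms by (simp_all add: has_expansion_def)

text \<open>Exponents may repeat in the given family. Collecting the terms over the fibres of \<phi>
  does not increase the weighted norm, by the triangle inequality.\<close>

lemma expansion_norm_leI:
  fixes b :: "'x \<Rightarrow> complex" and \<phi> :: "'x \<Rightarrow> (nat ^ 'k) \<times> (nat ^ 'k)"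
  assumes summ: "((\<lambda>x. cmod (b x) * weight (\<phi> x)) has_sum B') UNIV" and "B' \<le> B"
    and F: "\<And>z w. (\<And>i. cmod (z $ i) \<le> 2) \<Longrightarrow> (\<And>i. cmod (w $ i) \<le> 2) \<Longrightarrow>
      ((\<lambda>x. b x * bimonomial z w (\<phi> x)) has_sum F z w) UNIV"
  shows "expansion_norm_le F B"
proof -
  define fib where "fib \<gamma> = {x. \<phi> x = \<gamma>}" for \<gamma>
  define c where "c \<gamma> = infsum b (fib \<gamma>)" for \<gamma>
  have bij: "bij_betw snd (Sigma UNIV fib) UNIV"
    by (rule bij_betwI[of _ _ _ "\<lambda>x. (\<phi> x, x)"]) (auto simp: fib_def)
  have norm_b: "(\<lambda>x. cmod (b x)) summable_on fib \<gamma>" for \<gamma>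
  proof -
    have "(\<lambda>x. cmod (b x) * weight (\<phi> x)) summable_on fib \<gamma>"
      using has_sum_imp_summable[OF summ] by (rule summable_on_subset_banach) auto
    moreover have "(\<lambda>x. cmod (b x) * weight (\<phi> x)) summable_on fib \<gamma> \<longleftrightarrow>
        (\<lambda>x. cmod (b x) * weight \<gamma>) summable_on fib \<gamma>"
      by (rule summable_on_cong) (auto simp: fib_def)
    ultimately show ?thesis
      using weight_pos[of \<gamma>] by (simp add: summable_on_cmult_left')
  qed
  have b: "(b has_sum c \<gamma>) (fib \<gamma>)" for \<gamma>
    unfolding c_def using Infinite_Sum.abs_summable_summable[OF norm_b[of \<gamma>]] by (rule has_sum_infsum)
  define n where "n \<gamma> = (\<Sum>\<^sub>\<infinity>x\<in>fib \<gamma>. cmod (b x)) * weight \<gamma>" for \<gamma>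
  have n: "(n has_sum B') UNIV"
  proof (rule has_sum_SigmaD)
    show "((\<lambda>y. cmod (b (snd y)) * weight (\<phi> (snd y))) has_sum B') (Sigma UNIV fib)"
      using has_sum_reindex_bij_betw[OF bij, of "\<lambda>x. cmod (b x) * weight (\<phi> x)"] summ by simp
    show "((\<lambda>x. cmod (b (snd (\<gamma>, x))) * weight (\<phi> (snd (\<gamma>, x)))) has_sum n \<gamma>) (fib \<gamma>)" for \<gamma>
    proof -
      have "((\<lambda>x. cmod (b x) * weight \<gamma>) has_sum n \<gamma>) (fib \<gamma>)"
        unfolding n_def by (intro has_sum_cmult_left has_sum_infsum norm_b)
      then show ?thesis
        by (rule has_sum_cong[THEN iffD1, rotated]) (auto simp: fib_def)
    qed
  qed
  have le: "cmod (c \<gamma>) * weight \<gamma> \<le> n \<gamma>" for \<gamma>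
    unfolding n_def c_def using weight_pos[of \<gamma>]
    by (intro mult_right_mono norm_infsum_bound norm_b) auto
  have "(\<lambda>\<gamma>. norm (cmod (c \<gamma>) * weight \<gamma>)) summable_on UNIV"
    using has_sum_imp_summable[OF n]
    by (rule Infinite_Sum.abs_summable_on_comparison_test')
       (use le in \<open>simp add: abs_mult weight_nonneg\<close>)
  then have cs: "(\<lambda>\<gamma>. cmod (c \<gamma>) * weight \<gamma>) summable_on UNIV"
    by (rule summable_on_iff_abs_summable_on_real[THEN iffD2])
  have "(\<Sum>\<^sub>\<infinity>\<gamma>. cmod (c \<gamma>) * weight \<gamma>) \<le> B'"
    using has_sum_mono[OF has_sum_infsum[OF cs] n] le by blast
  moreover have "((\<lambda>\<gamma>. c \<gamma> * bimonomial z w \<gamma>) has_sum F z w) UNIV"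
    if zw: "\<And>i. cmod (z $ i) \<le> 2" "\<And>i. cmod (w $ i) \<le> 2" for z w
  proof (rule has_sum_SigmaD)
    show "((\<lambda>y. b (snd y) * bimonomial z w (\<phi> (snd y))) has_sum F z w) (Sigma UNIV fib)"
      using has_sum_reindex_bij_betw[OF bij, of "\<lambda>x. b x * bimonomial z w (\<phi> x)"] F[OF zw] by simp
    show "((\<lambda>x. b (snd (\<gamma>, x)) * bimonomial z w (\<phi> (snd (\<gamma>, x)))) has_sum c \<gamma> * bimonomial z w \<gamma>) (fib \<gamma>)" for \<gamma>
    proof -
      have "((\<lambda>x. b x * bimonomial z w \<gamma>) has_sum c \<gamma> * bimonomial z w \<gamma>) (fib \<gamma>)"
        by (intro has_sum_cmult_left b)
      then show ?thesis
        by (rule has_sum_cong[THEN iffD1, rotated]) (auto simp: fib_def)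
    qed
  qed
  ultimately show ?thesis
    unfolding expansion_norm_le_def has_expansion_def using cs \<open>B' \<le> B\<close> by (intro exI[of _ c]) auto
qed

lemma norm_expansion_le:
  assumes "expansion_norm_le F B" "\<And>i. cmod (z $ i) \<le> 2" "\<And>i. cmod (w $ i) \<le> 2"
  shows "cmod (F z w) \<le> B"
proof -
  obtain c where c': "has_expansion F c" and c2: "(\<Sum>\<^sub>\<infinity>\<gamma>. cmod (c \<gamma>) * weight \<gamma>) \<le> B"
    using assms(1) unfolding expansion_norm_le_def by blast
  note c = has_expansionD(1)[OF c'] c2 has_expansionD(2)[OF c' assms(2,3)]
  have "cmod (F z w) \<le> (\<Sum>\<^sub>\<infinity>\<gamma>. cmod (c \<gamma>) * weight \<gamma>)"
    using norm_infsum_le[OF c(3) has_sum_infsum[OF c(1)]] norm_bimonomial_le[OF assms(2,3)]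
    by (simp add: norm_mult mult_left_mono)
  then show ?thesis using c(2) by simp
qed

lemma expansion_norm_le_const: "expansion_norm_le (\<lambda>z w. a) (cmod a)"
  by (rule expansion_norm_leI[of "\<lambda>_ :: unit. a" "\<lambda>_. 0" "cmod a"])
     (auto simp: weight_0 bimonomial_0 intro!: has_sum_finiteI)

lemma expansion_norm_le_affine:
  fixes e :: "'k \<Rightarrow> (nat ^ 'k) \<times> (nat ^ 'k)"
  assumes "\<And>j. weight (e j) = 2" "\<And>z w. F z w = a + (\<Sum>j\<in>UNIV. l j * bimonomial z w (e j))"
    and "cmod a + (\<Sum>j\<in>UNIV. cmod (l j) * 2) \<le> B"
  shows "expansion_norm_le F B"
proof (rule expansion_norm_leI[OF _ assms(3)])
  have U: "finite (UNIV :: 'k option set)" "(UNIV :: 'k option set) = insert None (Some ` UNIV)"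
    by (auto simp: UNIV_option_conv)
  have *: "sum f (UNIV :: 'k option set) = f None + (\<Sum>j\<in>UNIV. f (Some j))" for f :: "'k option \<Rightarrow> 'b :: comm_monoid_add"
    unfolding U(2) by (subst sum.insert) (auto simp: sum.reindex)
  define b where "b x = (case x of None \<Rightarrow> a | Some j \<Rightarrow> l j)" for x
  define \<phi> where "\<phi> x = (case x of None \<Rightarrow> 0 | Some j \<Rightarrow> e j)" for x
  show "((\<lambda>x. cmod (b x) * weight (\<phi> x)) has_sum cmod a + (\<Sum>j\<in>UNIV. cmod (l j) * 2)) UNIV"
    by (rule has_sum_finiteI) (simp_all add: * b_def \<phi>_def weight_0 assms(1))
  show "((\<lambda>x. b x * bimonomial z w (\<phi> x)) has_sum F z w) UNIV" for z w
    by (rule has_sum_finiteI) (simp_all add: * b_def \<phi>_def bimonomial_0 assms(2))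
qed

lemma has_sum_times_nonneg:
  fixes f :: "'x \<Rightarrow> real" and g :: "'y \<Rightarrow> real"
  assumes "(f has_sum a) UNIV" "(g has_sum b) UNIV" "\<And>x. f x \<ge> 0" "\<And>y. g y \<ge> 0"
  shows "((\<lambda>(x, y). f x * g y) has_sum a * b) (UNIV \<times> UNIV)"
proof (rule has_sum_SigmaI)
  show inner: "((\<lambda>y. case (x, y) of (x, y) \<Rightarrow> f x * g y) has_sum f x * b) UNIV" for x
    using has_sum_cmult_right[OF assms(2)] by simp
  show outer: "((\<lambda>x. f x * b) has_sum a * b) UNIV"
    by (rule has_sum_cmult_left[OF assms(1)])
  show "(\<lambda>(x, y). f x * g y) summable_on UNIV \<times> UNIV"
    by (rule summable_on_SigmaI[OF inner has_sum_imp_summable[OF outer]]) (use assms in auto)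
qed

text \<open>The bounds make the double family over \<open>n\<close> and \<gamma> absolutely
  summable, so it can be regrouped by \<gamma>.\<close>

lemma expansion_norm_le_sum:
  fixes F :: "'i \<Rightarrow> complex ^ 'k \<Rightarrow> complex ^ 'k \<Rightarrow> complex"
  assumes F: "\<And>n. expansion_norm_le (F n) (B n)" and B: "B summable_on UNIV"
    and G: "\<And>z w. (\<And>i. cmod (z $ i) \<le> 2) \<Longrightarrow> (\<And>i. cmod (w $ i) \<le> 2) \<Longrightarrow>
      ((\<lambda>n. F n z w) has_sum G z w) UNIV"
  shows "expansion_norm_le G (infsum B UNIV)"
proof -
  have "\<forall>n. \<exists>c. has_expansion (F n) c \<and> (\<Sum>\<^sub>\<infinity>\<gamma>. cmod (c \<gamma>) * weight \<gamma>) \<le> B n"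
    using F unfolding expansion_norm_le_def by blast
  then obtain c where c': "\<And>n. has_expansion (F n) (c n)"
    and c2: "\<And>n. (\<Sum>\<^sub>\<infinity>\<gamma>. cmod (c n \<gamma>) * weight \<gamma>) \<le> B n"
    using choice[of "\<lambda>n c. has_expansion (F n) c \<and> (\<Sum>\<^sub>\<infinity>\<gamma>. cmod (c \<gamma>) * weight \<gamma>) \<le> B n"] by blast
  note c = has_expansionD(1)[OF c'] c2 has_expansionD(2)[OF c']
  define N where "N n = (\<Sum>\<^sub>\<infinity>\<gamma>. cmod (c n \<gamma>) * weight \<gamma>)" for n
  have N0: "N n \<ge> 0" for n
    unfolding N_def by (intro infsum_nonneg mult_nonneg_nonneg weight_nonneg norm_ge_zero)
  have "(\<lambda>n. norm (N n)) summable_on UNIV"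
    using B by (rule Infinite_Sum.abs_summable_on_comparison_test') (use c(2) N0 in \<open>auto simp: N_def\<close>)
  then have Ns: "N summable_on UNIV"
    by (rule summable_on_iff_abs_summable_on_real[THEN iffD2])
  define b where "b = (\<lambda>(n, \<gamma>). c n \<gamma>)"
  have inner: "((\<lambda>\<gamma>. cmod (b (n, \<gamma>)) * weight (snd (n, \<gamma>))) has_sum N n) UNIV" for n
    using has_sum_infsum[OF c(1)] by (simp add: b_def N_def)
  have summ: "(\<lambda>x. cmod (b x) * weight (snd x)) summable_on UNIV \<times> UNIV"
    by (rule summable_on_SigmaI[OF inner Ns]) (auto simp: weight_nonneg)
  show ?thesis
  proof (rule expansion_norm_leI[of b snd "infsum N UNIV"])
    show "((\<lambda>x. cmod (b x) * weight (snd x)) has_sum infsum N UNIV) UNIV"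
      using has_sum_SigmaI[OF inner has_sum_infsum[OF Ns] summ] by simp
    show "infsum N UNIV \<le> infsum B UNIV"
      by (rule infsum_mono[OF Ns B]) (simp add: c(2) N_def)
    fix z w :: "complex ^ 'k"
    assume zw: "\<And>i. cmod (z $ i) \<le> 2" "\<And>i. cmod (w $ i) \<le> 2"
    have "(\<lambda>x. norm (b x * bimonomial z w (snd x))) summable_on UNIV \<times> UNIV"
      by (rule Infinite_Sum.abs_summable_on_comparison_test'[OF summ])
         (simp add: norm_mult mult_left_mono norm_bimonomial_le[OF zw])
    then have s: "(\<lambda>x. b x * bimonomial z w (snd x)) summable_on UNIV \<times> UNIV"
      by (rule Infinite_Sum.abs_summable_summable)
    have "((\<lambda>x. b x * bimonomial z w (snd x)) has_sum G z w) (UNIV \<times> UNIV)"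
      by (rule has_sum_SigmaI[OF _ G[OF zw] s]) (use c(3)[OF zw] in \<open>simp_all add: b_def\<close>)
    then show "((\<lambda>x. b x * bimonomial z w (snd x)) has_sum G z w) UNIV" by simp
  qed
qed

lemma expansion_norm_le_mult:
  assumes "expansion_norm_le F B" "expansion_norm_le G C"
  shows "expansion_norm_le (\<lambda>z w. F z w * G z w) (B * C)"
proof -
  obtain c where c': "has_expansion F c" and c2: "(\<Sum>\<^sub>\<infinity>\<gamma>. cmod (c \<gamma>) * weight \<gamma>) \<le> B"
    using assms(1) unfolding expansion_norm_le_def by blast
  note c = has_expansionD(1)[OF c'] c2 has_expansionD(2)[OF c']
  obtain d where d': "has_expansion G d" and d2: "(\<Sum>\<^sub>\<infinity>\<gamma>. cmod (d \<gamma>) * weight \<gamma>) \<le> C"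
    using assms(2) unfolding expansion_norm_le_def by blast
  note d = has_expansionD(1)[OF d'] d2 has_expansionD(2)[OF d']
  define M N where "M = (\<Sum>\<^sub>\<infinity>\<gamma>. cmod (c \<gamma>) * weight \<gamma>)" and "N = (\<Sum>\<^sub>\<infinity>\<gamma>. cmod (d \<gamma>) * weight \<gamma>)"
  have nonneg: "M \<ge> 0" "N \<ge> 0"
    unfolding M_def N_def
    by (intro infsum_nonneg mult_nonneg_nonneg weight_nonneg norm_ge_zero; simp)+
  define b where "b = (\<lambda>(x, y). c x * d y)"
  define \<phi> where "\<phi> = (\<lambda>(x, y). x + y :: (nat ^ 'a) \<times> (nat ^ 'a))"
  have eq: "cmod (b x) * weight (\<phi> x) =
      (case x of (x, y) \<Rightarrow> (cmod (c x) * weight x) * (cmod (d y) * weight y))" for x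
    by (simp add: b_def \<phi>_def case_prod_unfold weight_add norm_mult)
  have summ: "((\<lambda>x. cmod (b x) * weight (\<phi> x)) has_sum M * N) UNIV"
    unfolding eq using has_sum_times_nonneg[OF has_sum_infsum[OF c(1)] has_sum_infsum[OF d(1)]]
    by (simp add: M_def N_def weight_nonneg)
  show ?thesis
  proof (rule expansion_norm_leI[OF summ])
    show "M * N \<le> B * C"
      using c(2) d(2) nonneg by (intro mult_mono) (auto simp: M_def N_def)
    fix z w :: "complex ^ 'a"
    assume zw: "\<And>i. cmod (z $ i) \<le> 2" "\<And>i. cmod (w $ i) \<le> 2"
    have "(\<lambda>x. norm (b x * bimonomial z w (\<phi> x))) summable_on UNIV \<times> UNIV"
      using has_sum_imp_summable[OF summ]
      by (intro Infinite_Sum.abs_summable_on_comparison_test'[of "\<lambda>x. cmod (b x) * weight (\<phi> x)"])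
         (simp_all add: norm_mult mult_left_mono norm_bimonomial_le[OF zw])
    then have s: "(\<lambda>x. b x * bimonomial z w (\<phi> x)) summable_on UNIV \<times> UNIV"
      by (rule Infinite_Sum.abs_summable_summable)
    have e: "b (x, y) * bimonomial z w (\<phi> (x, y)) = (c x * bimonomial z w x) * (d y * bimonomial z w y)" for x y
      by (simp add: b_def \<phi>_def bimonomial_add)
    have "((\<lambda>x. b x * bimonomial z w (\<phi> x)) has_sum F z w * G z w) (UNIV \<times> UNIV)"
    proof (rule has_sum_SigmaI[OF _ _ s])
      show "((\<lambda>y. b (x, y) * bimonomial z w (\<phi> (x, y))) has_sum (c x * bimonomial z w x) * G z w) UNIV" for x
        unfolding e by (intro has_sum_cmult_right d(3) zw)
      show "((\<lambda>x. (c x * bimonomial z w x) * G z w) has_sum F z w * G z w) UNIV"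
        by (intro has_sum_cmult_left c(3) zw)
    qed
    then show "((\<lambda>x. b x * bimonomial z w (\<phi> x)) has_sum F z w * G z w) UNIV" by simp
  qed
qed

lemma expansion_norm_le_power:
  "expansion_norm_le F B \<Longrightarrow> expansion_norm_le (\<lambda>z w. F z w ^ n) (B ^ n)"
proof (induction n)
  case 0
  then show ?case using expansion_norm_le_const[of 1] by simp
qed (auto intro: expansion_norm_le_mult)

lemma expansion_norm_le_prod:
  "finite I \<Longrightarrow> (\<And>i. i \<in> I \<Longrightarrow> expansion_norm_le (F i) (B i)) \<Longrightarrow>
    expansion_norm_le (\<lambda>z w. \<Prod>i\<in>I. F i z w) (\<Prod>i\<in>I. B i)"
proof (induction I rule: finite_induct)
  case empty
  then show ?case using expansion_norm_le_const[of 1] by simp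
qed (auto intro: expansion_norm_le_mult)

section \<open>Ranks and kernels\<close>

lemma cnj_vec_nth [simp]: "cnj_vec z $ i = cnj (z $ i)"
  by (simp add: cnj_vec_def)

lemma cnj_vec_cnj_vec [simp]: "cnj_vec (cnj_vec z) = z"
  by (simp add: vec_eq_iff)

lemma open_cnj_vec:
  assumes "open U" shows "open {w. cnj_vec w \<in> U}"
proof -
  have "continuous_on UNIV (cnj_vec :: complex ^ 'k \<Rightarrow> complex ^ 'k)"
    unfolding cnj_vec_def by (intro continuous_intros)
  from open_vimage[OF assms this] show ?thesis
    by (simp only: vimage_def)
qed

lemma convex_cnj_vec:
  assumes "convex U" shows "convex {w. cnj_vec w \<in> U}"
proof -
  have "linear (cnj_vec :: complex ^ 'k \<Rightarrow> complex ^ 'k)"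
    by (rule linearI) (simp_all add: vec_eq_iff)
  from convex_linear_vimage[OF this assms] show ?thesis
    by (simp add: vimage_def)
qed

lemma gateaux_holomorphic_compose:
  assumes "gateaux_holomorphic K A B"
    and "\<And>z u t. \<phi> (z + t *s u) = \<phi> z + t *s \<phi>' u" "\<And>w v t. \<psi> (w + t *s v) = \<psi> w + t *s \<psi>' v"
    and "\<phi> ` A' \<subseteq> A" "\<psi> ` B' \<subseteq> B"
  shows "gateaux_holomorphic (\<lambda>z w. K (\<phi> z) (\<psi> w)) A' B'"
  using assms(1,4,5) by (simp add: gateaux_holomorphic_def assms(2,3) image_subset_iff)

lemma gateaux_holomorphic_diff:
  "gateaux_holomorphic K A B \<Longrightarrow> gateaux_holomorphic L A B \<Longrightarrow>
    gateaux_holomorphic (\<lambda>z w. K z w - L z w) A B"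
  unfolding gateaux_holomorphic_def by (auto intro!: derivative_intros)

text \<open>Writing \<open>z = a + \<i> b\<close> and \<open>w = cnj a + \<i> cnj b\<close>, the pairs
  \<open>(a + t b, cnj a + t cnj b)\<close> lie on the antidiagonal for real \<open>t\<close>.\<close>

definition polar_a :: "complex ^ 'k \<Rightarrow> complex ^ 'k \<Rightarrow> complex ^ 'k" where
  "polar_a z w = (\<chi> i. (z $ i + cnj (w $ i)) / 2)"

definition polar_b :: "complex ^ 'k \<Rightarrow> complex ^ 'k \<Rightarrow> complex ^ 'k" where
  "polar_b z w = (\<chi> i. (z $ i - cnj (w $ i)) / (2 * \<i>))"

lemma polar_nth [simp]:
  "polar_a z w $ i = (z $ i + cnj (w $ i)) / 2" "polar_b z w $ i = (z $ i - cnj (w $ i)) / (2 * \<i>)"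
  by (simp_all add: polar_a_def polar_b_def)

lemma polar_eq:
  "polar_a z w + \<i> *s polar_b z w = z" "cnj_vec (polar_a z w) + \<i> *s cnj_vec (polar_b z w) = w"
  by (simp_all add: vec_eq_iff field_simps)

lemma polar_real:
  "cnj_vec (polar_a z w) + complex_of_real t *s cnj_vec (polar_b z w) =
   cnj_vec (polar_a z w + complex_of_real t *s polar_b z w)"
  by (simp add: vec_eq_iff)

text \<open>Both \<open>polar_a\<close> and \<open>polar_b\<close> are averages up to unimodular
  factors and stay within \<delta>; a parameter of modulus below 2 gives the factor 1 + 2.\<close>

lemma polar_polydisc:
  assumes "z \<in> polydisc \<delta>" "w \<in> polydisc \<delta>" "cmod t < 2"
  shows "polar_a z w + t *s polar_b z w \<in> polydisc (3 * \<delta>)"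
    "cnj_vec (polar_a z w) + t *s cnj_vec (polar_b z w) \<in> polydisc (3 * \<delta>)"
proof -
  have *: "cmod (a + t * b) < 3 * \<delta>" if "cmod a < \<delta>" "cmod b < \<delta>" for a b
  proof -
    have "cmod (a + t * b) \<le> cmod a + cmod t * cmod b"
      using norm_triangle_ineq[of a "t * b"] by (simp add: norm_mult)
    also have "cmod t * cmod b \<le> 2 * cmod b"
      using assms(3) by (intro mult_right_mono) auto
    finally show ?thesis using that by simp
  qed
  have zw: "cmod (z $ i) < \<delta>" "cmod (w $ i) < \<delta>" for i
    using assms by (auto simp: polydisc_def)
  have a: "cmod (polar_a z w $ i) < \<delta>" for i
    using norm_triangle_ineq[of "z $ i" "cnj (w $ i)"] zw[of i] by (simp add: norm_divide)
  have b: "cmod (polar_b z w $ i) < \<delta>" for i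
    using norm_triangle_ineq4[of "z $ i" "cnj (w $ i)"] zw[of i] by (simp add: norm_divide norm_mult)
  show "polar_a z w + t *s polar_b z w \<in> polydisc (3 * \<delta>)"
    using *[OF a b] by (simp add: polydisc_def del: polar_nth)
  show "cnj_vec (polar_a z w) + t *s cnj_vec (polar_b z w) \<in> polydisc (3 * \<delta>)"
    using *[of "cnj (polar_a z w $ i)" "cnj (polar_b z w $ i)" for i] a b
    by (simp add: polydisc_def del: polar_nth)
qed

text \<open>Applied to differences, this is uniqueness of the complexification: kernels that agree
  on the antidiagonal agree on a smaller product.\<close>

lemma gateaux_holomorphic_polarization:
  assumes H: "gateaux_holomorphic H (polydisc (3 * \<delta>)) (polydisc (3 * \<delta>))"
    and 0: "\<And>z. z \<in> polydisc (3 * \<delta>) \<Longrightarrow> H z (cnj_vec z) = 0"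
    and zw: "z \<in> polydisc \<delta>" "w \<in> polydisc \<delta>"
  shows "H z w = 0"
proof -
  define g where "g t = H (polar_a z w + t *s polar_b z w) (cnj_vec (polar_a z w) + t *s cnj_vec (polar_b z w))" for t
  have "g \<i> = 0"
  proof (rule holomorphic_eq_0_real)
    show "g holomorphic_on ball 0 2"
      unfolding g_def by (rule gateaux_holomorphic_line[OF H]) (use polar_polydisc[OF zw] in auto)
    show "g (of_real t) = 0" if "\<bar>t\<bar> < 2" for t
      unfolding g_def polar_real using that by (intro 0 polar_polydisc zw) auto
  qed
  then show ?thesis
    by (simp add: g_def polar_eq)
qed

section \<open>The rank at a point in terms of the kernel\<close>

lemma ones_in_closure: "(\<chi> i. 1) \<in> closure (unit_polydisc :: (complex ^ 'k) set)"
proof -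
  have "(\<lambda>n. (\<chi> i. 1 - 1 / of_nat (Suc n)) :: complex ^ 'k) \<longlonglongrightarrow> (\<chi> i. 1 - 0)"
    by (intro tendsto_vec_lambda tendsto_intros) (use LIMSEQ_inverse_real_of_nat in \<open>simp add: lim_1_over_n LIMSEQ_Suc[OF lim_1_over_n] del: of_nat_Suc\<close>)
  moreover have "((\<chi> i. 1 - 1 / of_nat (Suc n)) :: complex ^ 'k) \<in> unit_polydisc" for n
  proof -
    have "1 - 1 / of_nat (Suc n) = complex_of_real (1 - 1 / real (Suc n))"
      by simp
    then have "cmod (1 - 1 / of_nat (Suc n)) = 1 - 1 / real (Suc n)"
      by (simp only: norm_of_real) simp
    then show ?thesis by (simp add: unit_polydisc_def)
  qed
  ultimately show ?thesis
    unfolding closure_sequential by (intro exI[of _ "\<lambda>n. \<chi> i. 1 - 1 / of_nat (Suc n)"]) (simp del: of_nat_Suc)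
qed

lemma closure_unit_polydisc_le:
  fixes z :: "complex ^ 'k"
  assumes "z \<in> closure unit_polydisc"
  shows "cmod (z $ i) \<le> 1"
proof -
  have "closed {z :: complex ^ 'k. cmod (z $ i) \<le> 1}"
    by (intro closed_Collect_le continuous_intros)
  moreover have "unit_polydisc \<subseteq> {z :: complex ^ 'k. cmod (z $ i) \<le> 1}"
    by (auto simp: unit_polydisc_def less_imp_le)
  ultimately have "closure unit_polydisc \<subseteq> {z :: complex ^ 'k. cmod (z $ i) \<le> 1}"
    by (rule closure_minimal[rotated])
  then show ?thesis using assms by auto
qed

lemma polydisc_subset_nhd:
  assumes "open V" "0 \<in> V"
  obtains \<delta> where "\<delta> > 0" "\<And>d. d \<le> \<delta> \<Longrightarrow> polydisc d \<subseteq> (V :: (complex ^ 'k) set)"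
proof -
  obtain e where e: "e > 0" "ball 0 e \<subseteq> V"
    using assms open_contains_ball by blast
  define \<delta> where "\<delta> = e / (2 * CARD('k))"
  have "polydisc d \<subseteq> V" if "d \<le> \<delta>" for d
  proof
    fix z :: "complex ^ 'k" assume "z \<in> polydisc d"
    then have "cmod (z $ i) \<le> \<delta>" for i
      using that by (auto simp: polydisc_def intro: less_imp_le less_le_trans)
    then have "(\<Sum>i\<in>UNIV. cmod (z $ i)) \<le> CARD('k) * \<delta>"
      using sum_bounded_above[of UNIV "\<lambda>i. cmod (z $ i)" \<delta>] by simp
    then have "norm z \<le> e / 2"
      using L2_set_le_sum[of UNIV "\<lambda>i. cmod (z $ i)"] by (simp add: \<delta>_def norm_vec_def)
    then show "z \<in> V" using e by (auto simp: subset_iff)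
  qed
  moreover have "\<delta> > 0" using e by (simp add: \<delta>_def)
  ultimately show ?thesis using that by blast
qed

context
  fixes D :: "(complex ^ 'k) set" and K :: "complex ^ 'k \<Rightarrow> complex ^ 'k \<Rightarrow> complex"
    and f :: "complex ^ 'k \<Rightarrow> real"
  assumes D: "open D" "convex D"
    and K: "gateaux_holomorphic K D {w. cnj_vec w \<in> D}"
    and diag: "\<And>z. z \<in> D \<Longrightarrow> complex_of_real (f z) = K z (cnj_vec z)"
begin

text \<open>Polarization identifies the dilated series with \<open>K\<close> in coordinates around
  \<open>p\<close>, and continuation spreads its rank over \<open>D\<close>. As neither
  \<open>p\<close> nor \<open>t\<close> occurs on the right, this also shows independence of the
  point and of the dilation.\<close>

lemma operator_rank_dilated_matrix:
  assumes "p \<in> D" "dilated_matrix f p t c"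
  shows "operator_rank c \<le> enat N \<longleftrightarrow> kernel_rank_le K D {w. cnj_vec w \<in> D} N"
proof -
  let ?D' = "{w. cnj_vec w \<in> D}"
  obtain W where t: "t > 0" and ser: "complexified_series (\<lambda>z. f (p + t *\<^sub>R z)) 0 c"
    and W: "closure unit_polydisc \<times> closure unit_polydisc \<subseteq> W" "series_converges_on c W"
    using assms(2) unfolding dilated_matrix_def by blast
  \<comment> \<open>At the boundary point with all coordinates 1, convergence of the series is
    summability of the coefficients.\<close>
  have summ1: "(\<lambda>(\<alpha>, \<beta>). c \<alpha> \<beta> * monomial (\<chi> i. 1) \<alpha> * monomial (\<chi> i. 1) \<beta>) summable_on UNIV"
    using W ones_in_closure unfolding series_converges_on_def by blast
  then have summ: "(\<lambda>(\<alpha>, \<beta>). c \<alpha> \<beta>) summable_on UNIV"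
    by (simp add: monomial_def)
  have ks: "gateaux_holomorphic (kernel_series c) (polydisc 1) (polydisc 1)"
    using gateaux_holomorphic_kernel_series[OF summ1] by (simp add: polydisc_def)
  obtain \<epsilon> where \<epsilon>: "\<epsilon> > 0" and sum_f: "\<And>z. z \<in> ball 0 \<epsilon> \<Longrightarrow>
      ((\<lambda>(\<alpha>, \<beta>). c \<alpha> \<beta> * monomial z \<alpha> * monomial (cnj_vec z) \<beta>) has_sum complex_of_real (f (p + t *\<^sub>R z))) UNIV"
    using ser unfolding complexified_series_def by auto
  have ks_f: "kernel_series c z (cnj_vec z) = complex_of_real (f (p + t *\<^sub>R z))" if "z \<in> ball 0 \<epsilon>" for z
    using infsumI[OF sum_f[OF that]] by (simp add: kernel_series_def)
  define \<phi> where "\<phi> z = p + t *\<^sub>R z" for z :: "complex ^ 'k"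
  \<comment> \<open>The second variable is centered at \<open>cnj_vec p\<close>; since
    \<open>t\<close> is real, both variables are dilated alike and the antidiagonal is
    preserved.\<close>
  define \<psi> where "\<psi> w = cnj_vec p + t *\<^sub>R w" for w :: "complex ^ 'k"
  have \<psi>\<phi>: "cnj_vec (\<psi> w) = \<phi> (cnj_vec w)" for w
    by (simp add: \<psi>_def \<phi>_def vec_eq_iff)
  have line: "\<phi> (z + s *s u) = \<phi> z + s *s (t *\<^sub>R u)" "\<psi> (z + s *s u) = \<psi> z + s *s (t *\<^sub>R u)" for z u s
    by (simp_all add: \<phi>_def \<psi>_def vec_eq_iff algebra_simps)
  have "open (\<phi> -` D \<inter> {w. cnj_vec w \<in> \<phi> -` D} \<inter> ball 0 \<epsilon> \<inter> polydisc 1)"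
    unfolding \<phi>_def by (intro open_Int open_cnj_vec open_vimage D open_ball open_polydisc continuous_intros)
  moreover have "0 \<in> \<phi> -` D \<inter> {w. cnj_vec w \<in> \<phi> -` D} \<inter> ball 0 \<epsilon> \<inter> polydisc 1"
    using assms(1) \<epsilon> by (auto simp: \<phi>_def polydisc_def cnj_vec_def zero_vec_def[symmetric])
  ultimately obtain \<delta>0 where \<delta>0: "\<delta>0 > 0"
    "\<And>d. d \<le> \<delta>0 \<Longrightarrow> polydisc d \<subseteq> \<phi> -` D \<inter> {w. cnj_vec w \<in> \<phi> -` D} \<inter> ball 0 \<epsilon> \<inter> polydisc 1"
    by (rule polydisc_subset_nhd) blast
  \<comment> \<open>Polarization loses a factor 3, and the comparison with the coefficients wants a
    radius of at most 1.\<close>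
  define \<delta> where "\<delta> = min (\<delta>0 / 3) 1"
  have \<delta>: "\<delta> > 0" "\<delta> \<le> 1" "3 * \<delta> \<le> \<delta>0" "\<delta> \<le> \<delta>0"
    using \<delta>0(1) by (auto simp: \<delta>_def)
  have in1: "\<phi> ` polydisc (3 * \<delta>) \<subseteq> D" "\<psi> ` polydisc (3 * \<delta>) \<subseteq> ?D'"
    using \<delta>0(2)[OF \<delta>(3)] by (auto simp: \<psi>\<phi>)
  have in3: "polydisc (3 * \<delta>) \<subseteq> (ball 0 \<epsilon> :: (complex ^ 'k) set)" "polydisc (3 * \<delta>) \<subseteq> (polydisc 1 :: (complex ^ 'k) set)"
    using \<delta>0(2)[OF \<delta>(3)] by (simp_all only: le_inf_iff)
  have in2: "\<phi> ` polydisc \<delta> \<subseteq> D" "\<psi> ` polydisc \<delta> \<subseteq> ?D'"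
    using \<delta>0(2)[OF \<delta>(4)] by (auto simp: \<psi>\<phi>)
  define H where "H z w = kernel_series c z w - K (\<phi> z) (\<psi> w)" for z w
  have "gateaux_holomorphic H (polydisc (3 * \<delta>)) (polydisc (3 * \<delta>))"
    unfolding H_def
    by (intro gateaux_holomorphic_diff gateaux_holomorphic_mono[OF ks] gateaux_holomorphic_compose[OF K line] in1 in3)
  moreover have "H z (cnj_vec z) = 0" if "z \<in> polydisc (3 * \<delta>)" for z
  proof -
    have "\<psi> (cnj_vec z) = cnj_vec (\<phi> z)"
      by (simp add: \<psi>_def \<phi>_def vec_eq_iff)
    moreover have "\<phi> z \<in> D" "z \<in> ball 0 \<epsilon>"
      using that in1 in3 by blast+
    ultimately show ?thesis
      using ks_f[of z] diag[of "\<phi> z"] by (simp add: H_def) (simp add: \<phi>_def)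
  qed
  ultimately have "H z w = 0" if "z \<in> polydisc \<delta>" "w \<in> polydisc \<delta>" for z w
    using that by (rule gateaux_holomorphic_polarization)
  then have eq: "kernel_series c z w = K (\<phi> z) (\<psi> w)" if "z \<in> polydisc \<delta>" "w \<in> polydisc \<delta>" for z w
    using that by (simp add: H_def)
  have "operator_rank c \<le> enat N \<longleftrightarrow> kernel_rank_le (kernel_series c) (polydisc \<delta>) (polydisc \<delta>) N"
    using operator_rank_le_iff[OF summ] kernel_rank_le_coefficients[OF summ \<delta>(1,2)] by blast
  also have "\<dots> \<longleftrightarrow> kernel_rank_le (\<lambda>z w. K (\<phi> z) (\<psi> w)) (polydisc \<delta>) (polydisc \<delta>) N"
    by (simp add: kernel_rank_le_def eq)
  also have "\<dots> \<longleftrightarrow> kernel_rank_le K (\<phi> ` polydisc \<delta>) (\<psi> ` polydisc \<delta>) N"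
    by (rule kernel_rank_le_image)
  also have "\<dots> \<longleftrightarrow> kernel_rank_le K D ?D' N"
  proof
    assume "kernel_rank_le K (\<phi> ` polydisc \<delta>) (\<psi> ` polydisc \<delta>) N"
    moreover have "open (\<phi> ` polydisc \<delta>)" "open (\<psi> ` polydisc \<delta>)"
      using open_affinity[OF open_polydisc, of t] t unfolding \<phi>_def \<psi>_def by auto
    moreover have "\<phi> 0 \<in> \<phi> ` polydisc \<delta>" "\<psi> 0 \<in> \<psi> ` polydisc \<delta>"
      using \<delta>(1) by (auto simp: polydisc_def)
    ultimately show "kernel_rank_le K D ?D' N"
      using gateaux_kernel_rank_le_extend[OF K D open_cnj_vec[OF D(1)] convex_cnj_vec[OF D(2)]] in2 by blast
  next
    assume "kernel_rank_le K D ?D' N"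
    then show "kernel_rank_le K (\<phi> ` polydisc \<delta>) (\<psi> ` polydisc \<delta>) N"
      by (rule kernel_rank_le_mono) (use in2 in auto)
  qed
  finally show ?thesis .
qed

lemma rank_on_le_iff:
  assumes "D \<noteq> {}" and ex: "\<And>p. p \<in> D \<Longrightarrow> \<exists>c t. dilated_matrix f p t c"
  shows "rank_on f D \<le> enat N \<longleftrightarrow> kernel_rank_le K D {w. cnj_vec w \<in> D} N"
proof -
  have rank_at: "rank_at f p \<le> enat M \<longleftrightarrow> kernel_rank_le K D {w. cnj_vec w \<in> D} M" if p: "p \<in> D" for p M
  proof -
    obtain t where "dilated_matrix f p t (SOME c. \<exists>t. dilated_matrix f p t c)"
      using someI_ex[OF ex[OF p]] by blast
    then show ?thesis
      unfolding rank_at_def by (rule operator_rank_dilated_matrix[OF p])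
  qed
  obtain p0 where p0: "p0 \<in> D" using assms(1) by blast
  have const: "rank_at f p = rank_at f p0" if "p \<in> D" for p
  proof -
    \<comment> \<open>An extended natural number is determined by the natural numbers that bound it
      from above.\<close>
    have iff: "rank_at f p \<le> enat M \<longleftrightarrow> rank_at f p0 \<le> enat M" for M
      using rank_at[OF that] rank_at[OF p0] by simp
    show ?thesis
    proof (rule antisym)
      show "rank_at f p \<le> rank_at f p0"
        using iff by (cases "rank_at f p0") auto
      show "rank_at f p0 \<le> rank_at f p"
        using iff by (cases "rank_at f p") auto
    qed
  qed
  have "rank_on f D = rank_at f p0"
    unfolding rank_on_def
  proof (rule the_equality)
    show "\<forall>p\<in>D. rank_at f p = rank_at f p0"
      by (rule ballI) (rule const)
  qed (use p0 in auto)
  then show ?thesis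
    using rank_at[OF p0] by simp
qed

end

section \<open>Existence of dilated matrices\<close>

lemma expansion_norm_le_monomial:
  assumes "\<And>i. expansion_norm_le (\<lambda>z w. F z w $ i) (cmod (\<rho> $ i))"
  shows "expansion_norm_le (\<lambda>z w. monomial (F z w) \<alpha>) (cmod (monomial \<rho> \<alpha>))"
  unfolding norm_monomial unfolding monomial_def
  by (rule expansion_norm_le_prod[where F = "\<lambda>i z w. (F z w $ i) ^ (\<alpha> $ i)"])
     (simp_all add: expansion_norm_le_power assms)

text \<open>Without it the choice in \<open>rank_at\<close> would be arbitrary. For small
  \<open>t\<close> the components of the dilated affine map have expansion norms below the moduli of
  a point \<rho> of convergence, so the series can be re-expanded term by term.\<close>

lemma ex_dilated_matrix:
  fixes U :: "(complex ^ 'n) set" and M :: "complex ^ 'k ^ 'n"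
  assumes "open U" and conv: "series_converges_on c (U \<times> {w. cnj_vec w \<in> U})"
    and r: "\<And>z. z \<in> U \<Longrightarrow> complex_of_real (r z) = kernel_series c z (cnj_vec z)"
    and E: "\<And>z. E z = q + M *v z"
    and p: "E p \<in> U"
  shows "\<exists>c' t. dilated_matrix (r \<circ> E) p t c'"
proof -
  obtain \<rho> where \<rho>: "\<rho> \<in> U" "\<And>i. cmod (E p $ i) < cmod (\<rho> $ i)"
    using ex_inflated_point[OF assms(1) p] by blast
  \<comment> \<open>The weighted norm of the \<open>i\<close>-th component, a coordinate having
    weight 2. For \<open>t\<close> tending to 0 it tends to the modulus of \<open>E p $ i\<close>,
    which is below that of \<rho>.\<close>
  define b where "b t i = cmod (E p $ i) + (\<Sum>j\<in>UNIV. cmod (complex_of_real t * M $ i $ j) * 2)" for t i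
  have "eventually (\<lambda>t. b t i < cmod (\<rho> $ i)) (at_right 0)" for i
  proof (rule order_tendstoD(2))
    show "((\<lambda>t. b t i) \<longlongrightarrow> cmod (E p $ i) + (\<Sum>j\<in>UNIV. cmod (complex_of_real 0 * M $ i $ j) * 2)) (at_right 0)"
      unfolding b_def by (intro tendsto_intros)
  qed (use \<rho> in simp)
  then have "eventually (\<lambda>t. \<forall>i. b t i < cmod (\<rho> $ i)) (at_right 0)"
    by (intro eventually_all_finite) auto
  moreover have "eventually (\<lambda>t. t > 0) (at_right (0 :: real))"
    by (rule eventually_at_right_less)
  ultimately have "eventually (\<lambda>t. t > 0 \<and> (\<forall>i. b t i < cmod (\<rho> $ i))) (at_right 0)"
    by eventually_elim auto
  then obtain t where t: "t > 0" "\<And>i. b t i < cmod (\<rho> $ i)"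
    using eventually_happens[of _ "at_right (0::real)"] by (auto simp: trivial_limit_at_right_real)
  define \<phi> where "\<phi> z = E (p + t *\<^sub>R z)" for z
  \<comment> \<open>Conjugating twice makes this map holomorphic in \<open>w\<close>: it is \<phi>
    with conjugated coefficients.\<close>
  define \<psi> where "\<psi> w = cnj_vec (\<phi> (cnj_vec w))" for w
  have \<phi>: "\<phi> z $ i = E p $ i + (\<Sum>j\<in>UNIV. (complex_of_real t * M $ i $ j) * z $ j)" for z i
    by (simp add: \<phi>_def E matrix_vector_right_distrib matrix_vector_mult_def scaleR_conv_of_real[where 'a = complex] algebra_simps sum.distrib)
  have \<psi>: "\<psi> w $ i = cnj (E p $ i) + (\<Sum>j\<in>UNIV. cnj (complex_of_real t * M $ i $ j) * w $ j)" for w i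
    by (simp add: \<psi>_def \<phi>)
  have e1: "expansion_norm_le (\<lambda>z w. \<phi> z $ i) (cmod (\<rho> $ i))" for i
    by (rule expansion_norm_le_affine[of "\<lambda>j. (axis j 1, 0)" _ "E p $ i" "\<lambda>j. complex_of_real t * M $ i $ j"])
       (use t(2)[of i] in \<open>auto simp: weight_axis bimonomial_axis \<phi> b_def simp del: One_nat_def\<close>)
  have e2: "expansion_norm_le (\<lambda>z w. \<psi> w $ i) (cmod (cnj_vec \<rho> $ i))" for i
    by (rule expansion_norm_le_affine[of "\<lambda>j. (0, axis j 1)" _ "cnj (E p $ i)" "\<lambda>j. cnj (complex_of_real t * M $ i $ j)"])
       (use t(2)[of i] in \<open>auto simp: weight_axis bimonomial_axis \<psi> b_def norm_mult simp del: One_nat_def\<close>)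
  have summ: "(\<lambda>(\<alpha>, \<beta>). c \<alpha> \<beta> * monomial \<rho> \<alpha> * monomial (cnj_vec \<rho>) \<beta>) summable_on UNIV"
    using conv \<rho>(1) by (auto simp: series_converges_on_def)
  have conv': "(\<lambda>(\<alpha>, \<beta>). c \<alpha> \<beta> * monomial (\<phi> z) \<alpha> * monomial (\<psi> w) \<beta>) summable_on UNIV"
    if "\<And>i. cmod (z $ i) \<le> 2" "\<And>i. cmod (w $ i) \<le> 2" for z w
    by (rule kernel_series_summable_mono[OF summ])
       (use norm_expansion_le[OF e1 that] norm_expansion_le[OF e2 that] in auto)
  define F where "F x = (\<lambda>z w. c (fst x) (snd x) * monomial (\<phi> z) (fst x) * monomial (\<psi> w) (snd x))" for x
  define B where "B x = cmod (c (fst x) (snd x)) * cmod (monomial \<rho> (fst x)) * cmod (monomial (cnj_vec \<rho>) (snd x))" for x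
  have "expansion_norm_le (\<lambda>z w. kernel_series c (\<phi> z) (\<psi> w)) (infsum B UNIV)"
  proof (rule expansion_norm_le_sum)
    show "expansion_norm_le (F x) (B x)" for x
      unfolding F_def B_def
      by (intro expansion_norm_le_mult expansion_norm_le_const expansion_norm_le_monomial e1 e2)
    have "B = (\<lambda>x. cmod (case x of (\<alpha>, \<beta>) \<Rightarrow> c \<alpha> \<beta> * monomial \<rho> \<alpha> * monomial (cnj_vec \<rho>) \<beta>))"
      by (auto simp: B_def norm_mult)
    then show "B summable_on UNIV"
      using summ by (simp add: summable_on_iff_abs_summable_on_complex)
    show "((\<lambda>x. F x z w) has_sum kernel_series c (\<phi> z) (\<psi> w)) UNIV"
      if "\<And>i. cmod (z $ i) \<le> 2" "\<And>i. cmod (w $ i) \<le> 2" for z w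
      using has_sum_infsum[OF conv'[OF that]]
      by (simp add: F_def kernel_series_def case_prod_unfold)
  qed
  then obtain c0 where c0: "has_expansion (\<lambda>z w. kernel_series c (\<phi> z) (\<psi> w)) c0"
    unfolding expansion_norm_le_def by blast
  define c' where "c' \<alpha> \<beta> = c0 (\<alpha>, \<beta>)" for \<alpha> \<beta>
  have sum_c': "((\<lambda>(\<alpha>, \<beta>). c' \<alpha> \<beta> * monomial z \<alpha> * monomial w \<beta>) has_sum kernel_series c (\<phi> z) (\<psi> w)) UNIV"
    if "\<And>i. cmod (z $ i) \<le> 2" "\<And>i. cmod (w $ i) \<le> 2" for z w
    using has_expansionD(2)[OF c0 that]
    by (simp add: c'_def bimonomial_def case_prod_unfold mult.assoc)
  have conv2: "series_converges_on c' (polydisc 2 \<times> polydisc 2)"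
    unfolding series_converges_on_def
    using has_sum_imp_summable[OF sum_c'] by (auto simp: polydisc_def less_imp_le)
  have "open (\<phi> -` U)"
    unfolding \<phi>_def E matrix_vector_mult_def
    by (intro open_vimage assms(1) continuous_intros)
  moreover have "0 \<in> \<phi> -` U"
    using p by (simp add: \<phi>_def)
  ultimately obtain e where e: "e > 0" "ball 0 e \<subseteq> \<phi> -` U"
    using open_contains_ball by blast
  define \<epsilon> where "\<epsilon> = min e 1"
  have \<epsilon>: "\<epsilon> > 0" "ball 0 \<epsilon> \<subseteq> \<phi> -` U" "ball 0 \<epsilon> \<subseteq> (polydisc 2 :: (complex ^ 'k) set)"
    using e by (auto simp: \<epsilon>_def polydisc_def intro: le_less_trans[OF Finite_Cartesian_Product.norm_nth_le])
  have "complexified_series (\<lambda>z. (r \<circ> E) (p + t *\<^sub>R z)) 0 c'"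
    unfolding complexified_series_def
  proof (intro exI[of _ \<epsilon>] conjI ballI)
    show "series_converges_on c' (ball 0 \<epsilon> \<times> ball 0 \<epsilon>)"
      using conv2 \<epsilon>(3) unfolding series_converges_on_def by blast
    fix z :: "complex ^ 'k" assume z: "z \<in> ball 0 \<epsilon>"
    have "((\<lambda>(\<alpha>, \<beta>). c' \<alpha> \<beta> * monomial z \<alpha> * monomial (cnj_vec z) \<beta>) has_sum kernel_series c (\<phi> z) (\<psi> (cnj_vec z))) UNIV"
      using \<epsilon>(3) z by (intro sum_c') (auto simp: polydisc_def less_imp_le subset_iff)
    also have "kernel_series c (\<phi> z) (\<psi> (cnj_vec z)) = complex_of_real (r (\<phi> z))"
      using r[of "\<phi> z"] z \<epsilon>(2) by (auto simp: \<psi>_def)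
    finally show "((\<lambda>(\<alpha>, \<beta>). c' \<alpha> \<beta> * monomial z \<alpha> * monomial (cnj_vec z) \<beta>) has_sum
        complex_of_real ((r \<circ> E) (p + t *\<^sub>R (0 + z)))) UNIV"
      by (simp add: \<phi>_def)
  qed (use \<epsilon> in auto)
  moreover have "closure unit_polydisc \<times> closure unit_polydisc \<subseteq> polydisc 2 \<times> (polydisc 2 :: (complex ^ 'k) set)"
    by (auto simp: polydisc_def intro!: le_less_trans[OF closure_unit_polydisc_le])
  ultimately have "dilated_matrix (r \<circ> E) p t c'"
    unfolding dilated_matrix_def
    by (intro conjI exI[of _ "polydisc 2 \<times> polydisc 2"] open_Times open_polydisc t(1) conv2)
  then show ?thesis by blast
qed

section \<open>Analytic continuation along segments\<close>

text \<open>Real analyticity in one real variable, stated through a holomorphic extension so that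
  the identity theorem applies on each disc.\<close>

definition locally_holomorphic_at :: "(real \<Rightarrow> complex) \<Rightarrow> real \<Rightarrow> bool" where
  "locally_holomorphic_at u t0 \<longleftrightarrow>
     (\<exists>e>0. \<exists>h. h holomorphic_on ball (of_real t0) e \<and> (\<forall>t. \<bar>t - t0\<bar> < e \<longrightarrow> u t = h (of_real t)))"

lemma locally_holomorphic_eq_0:
  assumes u: "\<And>t. t \<in> J \<Longrightarrow> locally_holomorphic_at u t" and J: "open J" "connected J"
    and "t0 \<in> J" "eventually (\<lambda>t. u t = 0) (nhds t0)" and t1: "t1 \<in> J"
  shows "u t1 = 0"
proof -
  define Z where "Z = {t. eventually (\<lambda>s. u s = 0) (nhds t)}"
  define Z' where "Z' = J - Z"
  have "open Z"
    unfolding open_subopen[of Z]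
  proof
    fix t assume "t \<in> Z"
    then obtain S where S: "open S" "t \<in> S" "\<And>s. s \<in> S \<Longrightarrow> u s = 0"
      unfolding Z_def eventually_nhds by blast
    then have "S \<subseteq> Z"
      unfolding Z_def eventually_nhds by blast
    then show "\<exists>T. open T \<and> t \<in> T \<and> T \<subseteq> Z"
      using S by blast
  qed
  \<comment> \<open>If \<open>Z\<close> met this interval, the extension \<open>h\<close> would
    vanish on the whole disc, and \<open>t\<close> would belong to \<open>Z\<close>.\<close>
  have far: "\<exists>e>0. \<forall>s. \<bar>s - t\<bar> < e \<longrightarrow> s \<notin> Z" if t: "t \<in> Z'" for t
  proof -
    obtain e h where e: "e > 0" "h holomorphic_on ball (of_real t) e"
      "\<And>s. \<bar>s - t\<bar> < e \<Longrightarrow> u s = h (of_real s)"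
      using u[of t] t unfolding Z'_def locally_holomorphic_at_def by blast
    have "s \<notin> Z" if s: "\<bar>s - t\<bar> < e" for s
    proof
      assume "s \<in> Z"
      then obtain d where d: "d > 0" "\<And>x. \<bar>x - s\<bar> < d \<Longrightarrow> u x = 0"
        unfolding Z_def by (auto simp: eventually_nhds_metric dist_real_def)
      define V where "V = {s - d<..<s + d} \<inter> {t - e<..<t + e}"
      have V: "open V" "s \<in> V"
        using d s by (auto simp: V_def)
      have lim: "of_real s islimpt (complex_of_real ` V)"
        unfolding islimpt_approachable
      proof (intro allI impI)
        fix \<epsilon> :: real assume "\<epsilon> > 0"
        obtain \<eta> where \<eta>: "\<eta> > 0" "ball s \<eta> \<subseteq> V"
          using V open_contains_ball by blast
        define x where "x = s + min \<epsilon> \<eta> / 2"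
        have "x \<in> V" "x \<noteq> s" "dist x s < \<epsilon>"
          using \<eta> \<open>\<epsilon> > 0\<close> by (auto simp: x_def dist_real_def subset_iff)
        then show "\<exists>x'\<in>complex_of_real ` V. x' \<noteq> of_real s \<and> dist x' (of_real s) < \<epsilon>"
          by (intro bexI[of _ "of_real x"]) (auto simp: dist_of_real)
      qed
      have h0: "h w = 0" if "w \<in> ball (of_real t) e" for w
      proof (rule analytic_continuation[OF e(2) _ _ _ _ lim])
        show "complex_of_real ` V \<subseteq> ball (of_real t) e"
          by (auto simp: V_def dist_real_def dist_of_real)
        show "h x = 0" if x: "x \<in> complex_of_real ` V" for x
        proof -
          obtain y where y: "y \<in> V" "x = of_real y" using x by blast
          then have "\<bar>y - s\<bar> < d" "\<bar>y - t\<bar> < e" by (auto simp: V_def)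
          then show ?thesis using d(2)[of y] e(3)[of y] y by simp
        qed
      qed (use s that in \<open>auto simp: dist_of_real dist_real_def\<close>)
      have "u x = 0" if "\<bar>x - t\<bar> < e" for x
        using that e(3)[OF that] h0[of "of_real x"] by (auto simp: dist_of_real dist_real_def)
      then have "t \<in> Z"
        unfolding Z_def using e(1) by (auto simp: eventually_nhds_metric dist_real_def)
      then show False using t by (simp add: Z'_def)
    qed
    then show ?thesis using e(1) by blast
  qed
  have "open Z'"
    unfolding open_dist
  proof
    fix t assume t: "t \<in> Z'"
    obtain e where e: "e > 0" "\<And>s. \<bar>s - t\<bar> < e \<Longrightarrow> s \<notin> Z" using far[OF t] by blast
    obtain d where d: "d > 0" "\<And>s. dist s t < d \<Longrightarrow> s \<in> J"
      using J(1) t unfolding open_dist Z'_def by blast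
    show "\<exists>e>0. \<forall>y. dist y t < e \<longrightarrow> y \<in> Z'"
      using e d by (intro exI[of _ "min e d"]) (auto simp: Z'_def dist_real_def)
  qed
  then have "Z \<inter> J = {} \<or> Z' \<inter> J = {}"
    using \<open>open Z\<close> by (intro connectedD[OF J(2)]) (auto simp: Z'_def)
  then have "t1 \<in> Z"
    using assms(4,5) t1 by (auto simp: Z'_def Z_def)
  then show ?thesis
    unfolding Z_def using eventually_nhds_x_imp_x by blast
qed

text \<open>Along a ray each real monomial is a constant times a power of the parameter, and
  absolute convergence allows complex parameters.\<close>

lemma real_analytic_on_line:
  assumes "real_analytic_on r U" "t0 *\<^sub>R z \<in> U"
  shows "locally_holomorphic_at (\<lambda>t. complex_of_real (r (t *\<^sub>R z))) t0"
proof -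
  obtain \<epsilon> a where \<epsilon>: "\<epsilon> > 0" and a: "\<And>x. norm x < \<epsilon> \<Longrightarrow>
      ((\<lambda>\<gamma>. a \<gamma> * (\<Prod>b\<in>Basis. (x \<bullet> b) ^ \<gamma> b)) has_sum r (t0 *\<^sub>R z + x)) (Basis \<rightarrow>\<^sub>E UNIV)"
    using assms unfolding real_analytic_on_def by meson
  \<comment> \<open>The summand 1 covers \<open>z = 0\<close>, and the factor 1/2 keeps the closed
    disc inside the region of convergence.\<close>
  define e where "e = \<epsilon> / 2 / (norm z + 1)"
  have e0: "e > 0"
    using \<epsilon> by (auto simp: e_def add_nonneg_pos)
  have e: "norm (s *\<^sub>R z) < \<epsilon>" if "\<bar>s\<bar> \<le> e" for s
  proof -
    have "norm (s *\<^sub>R z) \<le> e * norm z"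
      using that by (simp add: mult_right_mono)
    also have "\<dots> \<le> e * (norm z + 1)"
      using e0 by simp
    also have "\<dots> = \<epsilon> / 2"
    proof -
      have "norm z + 1 \<noteq> 0"
        using norm_ge_zero[of z] by linarith
      then show ?thesis
        unfolding e_def by (rule nonzero_eq_divide_eq[THEN iffD1]) simp
    qed
    finally show ?thesis
      using \<epsilon> by simp
  qed
  define b where "b \<gamma> = a \<gamma> * (\<Prod>b\<in>Basis. (z \<bullet> b) ^ \<gamma> b)" for \<gamma>
  define deg where "deg \<gamma> = (\<Sum>b\<in>Basis. \<gamma> b)" for \<gamma> :: "'a \<Rightarrow> nat"
  have term_eq: "a \<gamma> * (\<Prod>b\<in>Basis. ((s *\<^sub>R z) \<bullet> b) ^ \<gamma> b) = b \<gamma> * s ^ deg \<gamma>" for \<gamma> s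
    by (simp add: b_def deg_def power_mult_distrib prod.distrib power_sum mult_ac)
  have sum_r: "((\<lambda>\<gamma>. b \<gamma> * s ^ deg \<gamma>) has_sum r (t0 *\<^sub>R z + s *\<^sub>R z)) (Basis \<rightarrow>\<^sub>E UNIV)" if "\<bar>s\<bar> \<le> e" for s
    using a[OF e[OF that]] unfolding term_eq .
  define h where "h w = (\<Sum>\<^sub>\<infinity>\<gamma>\<in>Basis \<rightarrow>\<^sub>E UNIV. complex_of_real (b \<gamma>) * (w - of_real t0) ^ deg \<gamma>)" for w
  have ul: "uniform_limit (cball (of_real t0) e)
      (\<lambda>X w. \<Sum>\<gamma>\<in>X. complex_of_real (b \<gamma>) * (w - of_real t0) ^ deg \<gamma>) h
      (finite_subsets_at_top (Basis \<rightarrow>\<^sub>E UNIV))"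
    unfolding h_def
  proof (rule Weierstrass_m_test_general)
    have "(\<lambda>\<gamma>. b \<gamma> * e ^ deg \<gamma>) summable_on Basis \<rightarrow>\<^sub>E UNIV"
      using has_sum_imp_summable[OF sum_r[of e]] e0 by simp
    then show "(\<lambda>\<gamma>. norm (b \<gamma> * e ^ deg \<gamma>)) summable_on Basis \<rightarrow>\<^sub>E UNIV"
      by (rule summable_on_iff_abs_summable_on_real[THEN iffD1])
    fix \<gamma> w assume "w \<in> cball (complex_of_real t0) e"
    then have "cmod (w - of_real t0) \<le> e"
      by (simp add: dist_norm norm_minus_commute)
    then have "cmod (w - of_real t0) ^ deg \<gamma> \<le> e ^ deg \<gamma>"
      by (intro power_mono) auto
    then show "cmod (complex_of_real (b \<gamma>) * (w - of_real t0) ^ deg \<gamma>) \<le> norm (b \<gamma> * e ^ deg \<gamma>)"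
      using e0 by (simp add: norm_mult norm_power abs_mult mult_left_mono)
  qed
  have "h holomorphic_on ball (of_real t0) e"
  proof (rule holomorphic_uniform_limit[OF _ ul])
    have "(\<lambda>w. \<Sum>\<gamma>\<in>X. complex_of_real (b \<gamma>) * (w - of_real t0) ^ deg \<gamma>) holomorphic_on S" for X S
      by (intro holomorphic_intros)
    then show "eventually (\<lambda>X. continuous_on (cball (of_real t0) e) (\<lambda>w. \<Sum>\<gamma>\<in>X. complex_of_real (b \<gamma>) * (w - of_real t0) ^ deg \<gamma>) \<and>
        (\<lambda>w. \<Sum>\<gamma>\<in>X. complex_of_real (b \<gamma>) * (w - of_real t0) ^ deg \<gamma>) holomorphic_on ball (of_real t0) e)
        (finite_subsets_at_top (Basis \<rightarrow>\<^sub>E UNIV))"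
      by (intro always_eventually allI conjI holomorphic_on_imp_continuous_on)
  qed auto
  moreover have "complex_of_real (r (t *\<^sub>R z)) = h (of_real t)" if "\<bar>t - t0\<bar> < e" for t
  proof -
    have "((\<lambda>\<gamma>. complex_of_real (b \<gamma> * (t - t0) ^ deg \<gamma>)) has_sum
        complex_of_real (r (t0 *\<^sub>R z + (t - t0) *\<^sub>R z))) (Basis \<rightarrow>\<^sub>E UNIV)"
      using sum_r[of "t - t0"] that by (intro has_sum_of_real) auto
    then show ?thesis
      unfolding h_def by (intro infsumI[symmetric]) (simp add: algebra_simps)
  qed
  ultimately show ?thesis
    unfolding locally_holomorphic_at_def using e0 by blast
qed

text \<open>The series is known to represent \<open>r\<close> near the origin only. Both sides are
  analytic along the real line through 0 and \<open>z\<close>, which meets the convex set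
  \<open>U\<close> in an interval.\<close>

lemma real_analytic_on_eq_kernel:
  fixes U :: "(complex ^ 'n) set"
  assumes U: "open U" "convex U" "0 \<in> U" and r: "real_analytic_on r U"
    and K: "gateaux_holomorphic K U {w. cnj_vec w \<in> U}"
    and near: "\<epsilon> > 0" "\<And>z. z \<in> ball 0 \<epsilon> \<Longrightarrow> complex_of_real (r z) = K z (cnj_vec z)"
    and z: "z \<in> U"
  shows "complex_of_real (r z) = K z (cnj_vec z)"
proof -
  define J where "J = {t :: real. t *\<^sub>R z \<in> U}"
  define u where "u t = complex_of_real (r (t *\<^sub>R z)) - K (t *\<^sub>R z) (cnj_vec (t *\<^sub>R z))" for t
  have J: "J = (\<lambda>t. t *\<^sub>R z) -` U" by (auto simp: J_def)
  have "open J"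
    unfolding J by (intro open_vimage U continuous_intros)
  have "connected J"
    unfolding J by (intro convex_connected convex_linear_vimage U linear_scaleR_left)
  have hol: "locally_holomorphic_at u t0" if t0: "t0 \<in> J" for t0
  proof -
    obtain e1 h1 where h1: "e1 > 0" "h1 holomorphic_on ball (of_real t0) e1"
      "\<And>t. \<bar>t - t0\<bar> < e1 \<Longrightarrow> complex_of_real (r (t *\<^sub>R z)) = h1 (of_real t)"
      using real_analytic_on_line[OF r, of t0 z] t0 unfolding J_def locally_holomorphic_at_def by blast
    define S where "S = {t. 0 + t *s z \<in> U} \<inter> {t. 0 + t *s cnj_vec z \<in> {w. cnj_vec w \<in> U}}"
    have sc: "complex_of_real t *s z = t *\<^sub>R z" "complex_of_real t *s cnj_vec z = cnj_vec (t *\<^sub>R z)" for t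
      by (simp_all add: vec_eq_iff scaleR_conv_of_real[where 'a = complex])
    have "open S"
      unfolding S_def by (intro open_Int open_line_preimage open_cnj_vec U)
    moreover have "of_real t0 \<in> S"
      using t0 by (simp add: S_def sc J_def)
    ultimately obtain e2 where e2: "e2 > 0" "ball (of_real t0) e2 \<subseteq> S"
      using open_contains_ball by blast
    define h2 where "h2 t = K (0 + t *s z) (0 + t *s cnj_vec z)" for t
    have h2: "h2 holomorphic_on S"
      unfolding h2_def by (rule gateaux_holomorphic_line[OF K]) (auto simp: S_def)
    show ?thesis
      unfolding locally_holomorphic_at_def
    proof (intro exI[of _ "min e1 e2"] exI[of _ "\<lambda>w. h1 w - h2 w"] conjI allI impI)
      show "(\<lambda>w. h1 w - h2 w) holomorphic_on ball (of_real t0) (min e1 e2)"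
        by (intro holomorphic_intros holomorphic_on_subset[OF h1(2)] holomorphic_on_subset[OF h2])
           (use e2(2) in auto)
      show "u t = h1 (of_real t) - h2 (of_real t)" if "\<bar>t - t0\<bar> < min e1 e2" for t
        using that h1(3)[of t] by (simp add: u_def h2_def sc)
    qed (use h1 e2 in auto)
  qed
  have "eventually (\<lambda>t. u t = 0) (nhds 0)"
  proof -
    have "open ((\<lambda>t. t *\<^sub>R z) -` ball 0 \<epsilon>)"
      by (intro open_vimage open_ball continuous_intros)
    moreover have "0 \<in> (\<lambda>t. t *\<^sub>R z) -` ball 0 \<epsilon>" using near by simp
    ultimately show ?thesis
      unfolding eventually_nhds
      by (intro exI[of _ "(\<lambda>t. t *\<^sub>R z) -` ball 0 \<epsilon>"]) (auto simp: u_def near(2) simp del: mem_ball)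
  qed
  then have "u 1 = 0"
    by (intro locally_holomorphic_eq_0[of J u 0 1] hol \<open>open J\<close> \<open>connected J\<close>)
       (use U z in \<open>auto simp: J_def\<close>)
  then show ?thesis by (simp add: u_def)
qed

section \<open>Restrictions to affine subspaces\<close>

lemma affine_embedding_matrix:
  assumes "affine_embedding E"
  obtains q M where "\<And>z. E z = q + M *v z"
proof -
  obtain p A where E: "Vector_Spaces.linear (*s) (*s) A" "E = (\<lambda>z. p + A z)"
    using assms unfolding affine_embedding_def by blast
  have "A z = matrix A *v z" for z
    using matrix_works[OF E(1)] by simp
  then show ?thesis
    using that[of p "matrix A"] E(2) by simp
qed

text \<open>Guarantees that the choice of \<open>E\<close> in \<open>rank_restrict\<close>
  succeeds.\<close>

lemma ex_affine_embedding:
  assumes "L \<in> affine_grassmannian CARD('m::finite)"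
  shows "\<exists>E :: complex ^ 'm \<Rightarrow> complex ^ 'n. affine_embedding E \<and> range E = L"
proof -
  obtain p V where V: "vec.subspace V" "vec.dim V = CARD('m)" "L = (\<lambda>v. p + v) ` V"
    using assms unfolding affine_grassmannian_def by blast
  obtain B where B: "B \<subseteq> V" "vec.independent B" "V \<subseteq> vec.span B" "card B = vec.dim V"
    by (rule vec.basis_exists)
  have spanB: "vec.span B = V"
    using B V(1) by (meson vec.span_minimal subset_antisym)
  have "finite B" using B(2) by (rule vec.finiteI_independent)
  let ?C = "cart_basis :: (complex ^ 'm) set"
  have C: "finite ?C" "vec.independent ?C" "vec.span ?C = UNIV" "card ?C = CARD('m)"
    using finite_cart_basis independent_cart_basis span_cart_basis card_cart_basis by auto
  obtain g where g: "bij_betw g ?C B"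
    using finite_same_card_bij[of ?C B] C \<open>finite B\<close> B(4) V(2) by auto
  obtain A where A: "Vector_Spaces.linear (*s) (*s) A" "\<forall>x\<in>?C. A x = g x"
    using vec.linear_independent_extend[OF C(2)] by blast
  interpret A: Vector_Spaces.linear "(*s)" "(*s)" A by (rule A(1))
  have AC: "A ` ?C = B"
    using A(2) g by (auto simp: bij_betw_def)
  have range: "range A = V"
    using vec.linear_span_image[OF A(1), of ?C] C(3) AC spanB by simp
  have "inj A"
  proof -
    have "inj_on A ?C"
      using A(2) g by (auto simp: bij_betw_def inj_on_def)
    then have "inj_on A (vec.span ?C)"
      using AC B(2) by (intro vec.linear_inj_on_span_independent_image[OF A(1)]) simp_all
    then show ?thesis using C(3) by simp
  qed
  then have "affine_embedding (\<lambda>z. p + A z)" "range (\<lambda>z. p + A z) = L"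
    using A(1) V(3) range unfolding affine_embedding_def by auto
  then show ?thesis by blast
qed

text \<open>Reduces the hypothesis to lines, by extending a direction to a basis. Admitting
  \<open>v = 0\<close> avoids checking polarized directions and also yields a subspace through a
  given point.\<close>

lemma ex_grassmannian_line:
  assumes "1 \<le> m" "m \<le> CARD('n)"
  shows "\<exists>L\<in>affine_grassmannian m. \<forall>t. p + t *s v \<in> (L :: (complex ^ 'n) set)"
proof -
  have ex: "\<exists>V. vec.subspace V \<and> vec.dim V = m \<and> u \<in> V" if "u \<noteq> 0" for u :: "complex ^ 'n"
  proof -
    have "vec.independent {u}" using that by (simp add: vec.independent_insert)
    then obtain B where B: "{u} \<subseteq> B" "vec.independent B" "UNIV \<subseteq> vec.span B"
      using vec.maximal_independent_subset_extend[of "{u}" UNIV] by auto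
    have fin: "finite B" using B(2) by (rule vec.finiteI_independent)
    have "card B = vec.dim (UNIV :: (complex ^ 'n) set)"
      using vec.basis_card_eq_dim[of B UNIV] B by auto
    then have "card B = CARD('n)"
      by (simp add: vec.dim_UNIV card_cart_basis)
    then have "m - 1 \<le> card (B - {u})"
      using assms B(1) fin by simp
    then obtain C where C: "C \<subseteq> B - {u}" "card C = m - 1" "finite C"
      by (rule obtain_subset_with_card_n)
    have "vec.independent (insert u C)"
      using B C vec.independent_mono[of B "insert u C"] by auto
    then have "vec.dim (vec.span (insert u C)) = card (insert u C)"
      by (rule vec.dim_span_eq_card_independent)
    also have "\<dots> = m"
      using C assms(1) by (subst card_insert_disjoint) auto
    finally show ?thesis
      by (intro exI[of _ "vec.span (insert u C)"]) (auto intro: vec.span_base)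
  qed
  obtain u :: "complex ^ 'n" where u: "u \<noteq> 0" "v \<noteq> 0 \<longrightarrow> u = v"
    using vec_eq_iff[of "1 :: complex ^ 'n" 0] by (cases "v = 0") auto
  obtain V where V: "vec.subspace V" "vec.dim V = m" "u \<in> V"
    using ex[OF u(1)] by blast
  have "v \<in> V"
    using u V vec.subspace_0[OF V(1)] by (cases "v = 0") auto
  then have "p + t *s v \<in> (\<lambda>x. p + x) ` V" for t
    using vec.subspace_scale[OF V(1)] by auto
  moreover have "(\<lambda>x. p + x) ` V \<in> affine_grassmannian m"
    unfolding affine_grassmannian_def using V by blast
  ultimately show ?thesis by blast
qed

section \<open>Restrictions of the kernel\<close>

context
  fixes U :: "(complex ^ 'n) set" and r :: "complex ^ 'n \<Rightarrow> real"
    and c :: "nat ^ 'n \<Rightarrow> nat ^ 'n \<Rightarrow> complex"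
  assumes U: "open U" "convex U"
    and conv: "series_converges_on c (U \<times> {w. cnj_vec w \<in> U})"
    and diag: "\<And>z. z \<in> U \<Longrightarrow> complex_of_real (r z) = kernel_series c z (cnj_vec z)"
begin

lemma kernel_gateaux_holomorphic:
  "gateaux_holomorphic (kernel_series c) U {w. cnj_vec w \<in> U}"
  by (rule gateaux_holomorphic_kernel_series_open[OF U(1) open_cnj_vec[OF U(1)] conv])

lemma rank_on_affine_le_iff:
  fixes M :: "complex ^ 'k ^ 'n"
  assumes E: "\<And>z. E z = q + M *v z" and ne: "E -` U \<noteq> {}"
  shows "rank_on (r \<circ> E) (E -` U) \<le> enat N \<longleftrightarrow>
    kernel_rank_le (kernel_series c) (range E \<inter> U) {w. cnj_vec w \<in> range E \<inter> U} N"
proof -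
  \<comment> \<open>The conjugate affine map: it is holomorphic in \<open>w\<close>, and together
    with \<open>E\<close> it carries the antidiagonal to the antidiagonal.\<close>
  define E' where "E' w = cnj_vec (E (cnj_vec w))" for w
  have line: "E (z + t *s u) = E z + t *s (M *v u)"
    "E' (z + t *s u) = E' z + t *s cnj_vec (M *v cnj_vec u)" for z u t
    by (simp_all add: E'_def E vec_eq_iff matrix_vector_mult_def sum.distrib sum_distrib_left algebra_simps)
  have "open (E -` U)"
    unfolding E matrix_vector_mult_def by (intro open_vimage U(1) continuous_intros)
  moreover have "convex (E -` U)"
  proof (rule convexI)
    fix x y and a b :: real
    assume *: "x \<in> E -` U" "y \<in> E -` U" "0 \<le> a" "0 \<le> b" "a + b = 1"
    have "a *\<^sub>R q + b *\<^sub>R q = q"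
      using *(5) by (metis scaleR_add_left scaleR_one)
    moreover have "M *v (a *\<^sub>R x + b *\<^sub>R y) = a *\<^sub>R (M *v x) + b *\<^sub>R (M *v y)"
      by (simp add: vec_eq_iff matrix_vector_mult_def sum.distrib scaleR_sum_right algebra_simps)
    moreover have "a *\<^sub>R E x + b *\<^sub>R E y = (a *\<^sub>R q + b *\<^sub>R q) + (a *\<^sub>R (M *v x) + b *\<^sub>R (M *v y))"
      by (simp add: E scaleR_add_right)
    ultimately have "E (a *\<^sub>R x + b *\<^sub>R y) = a *\<^sub>R E x + b *\<^sub>R E y"
      by (simp add: E)
    then show "a *\<^sub>R x + b *\<^sub>R y \<in> E -` U"
      using convexD[OF U(2)] * by simp
  qed
  moreover have "gateaux_holomorphic (\<lambda>z w. kernel_series c (E z) (E' w)) (E -` U) {w. cnj_vec w \<in> E -` U}"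
    by (rule gateaux_holomorphic_compose[OF kernel_gateaux_holomorphic line]) (auto simp: E'_def)
  moreover have "complex_of_real ((r \<circ> E) z) = kernel_series c (E z) (E' (cnj_vec z))" if "z \<in> E -` U" for z
    using diag[of "E z"] that by (simp add: E'_def)
  moreover have "\<exists>c' t. dilated_matrix (r \<circ> E) p t c'" if "p \<in> E -` U" for p
    using ex_dilated_matrix[OF U(1) conv diag E, of p] that by simp
  ultimately have "rank_on (r \<circ> E) (E -` U) \<le> enat N \<longleftrightarrow>
      kernel_rank_le (\<lambda>z w. kernel_series c (E z) (E' w)) (E -` U) {w. cnj_vec w \<in> E -` U} N"
    using ne by (intro rank_on_le_iff)
  also have "\<dots> \<longleftrightarrow> kernel_rank_le (kernel_series c) (E ` (E -` U)) (E' ` {w. cnj_vec w \<in> E -` U}) N"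
    by (rule kernel_rank_le_image)
  also have "E ` (E -` U) = range E \<inter> U" by auto
  also have "E' ` {w. cnj_vec w \<in> E -` U} = {w. cnj_vec w \<in> range E \<inter> U}"
  proof
    show "{w. cnj_vec w \<in> range E \<inter> U} \<subseteq> E' ` {w. cnj_vec w \<in> E -` U}"
    proof
      fix w assume "w \<in> {w. cnj_vec w \<in> range E \<inter> U}"
      then obtain x where "cnj_vec w = E x" "E x \<in> U" by auto
      then have "w = E' (cnj_vec x)"
        using cnj_vec_cnj_vec[of w] by (simp add: E'_def)
      then show "w \<in> E' ` {w. cnj_vec w \<in> E -` U}"
        using \<open>E x \<in> U\<close> by auto
    qed
  qed (auto simp: E'_def)
  finally show ?thesis .
qed

lemma rank_on_le_iff_kernel:
  assumes "U \<noteq> {}"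
  shows "rank_on r U \<le> enat N \<longleftrightarrow> kernel_rank_le (kernel_series c) U {w. cnj_vec w \<in> U} N"
  using rank_on_affine_le_iff[of "\<lambda>z. z" 0 "mat 1" N] assms by (simp add: o_def)

lemma rank_restrict_leD:
  assumes "rank_restrict TYPE('m::finite) r U L \<le> ereal (real N)" "L \<in> affine_grassmannian CARD('m)"
  shows "kernel_rank_le (kernel_series c) (L \<inter> U) {w. cnj_vec w \<in> L \<inter> U} N"
proof (cases "L \<inter> U = {}")
  case True
  then show ?thesis by (auto simp: kernel_rank_le_def)
next
  case False
  define E :: "complex ^ 'm \<Rightarrow> complex ^ 'n" where "E = (SOME E. affine_embedding E \<and> range E = L)"
  have E: "affine_embedding E" "range E = L"
    unfolding E_def using someI_ex[OF ex_affine_embedding[OF assms(2)]] by auto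
  obtain q M where M: "\<And>z. E z = q + M *v z"
    using affine_embedding_matrix[OF E(1)] by blast
  have "ereal_of_enat (rank_on (r \<circ> E) (E -` U)) \<le> ereal_of_enat (enat N)"
    using assms(1) False by (simp add: rank_restrict_def E_def Let_def)
  then have "rank_on (r \<circ> E) (E -` U) \<le> enat N"
    by (simp only: ereal_of_enat_le_iff)
  moreover have "E -` U \<noteq> {}"
    using False E(2) by auto
  ultimately show ?thesis
    using rank_on_affine_le_iff[OF M] E(2) by simp
qed

text \<open>After polarization the two lines may have different directions, so pairs of lines parallel to
  different coordinate axes are controlled as well.\<close>

lemma kernel_rank_le_of_restrictions:
  assumes "0 \<in> U" "1 \<le> CARD('m::finite)" "CARD('m) \<le> CARD('n)"
    and rank: "\<And>L. L \<in> affine_grassmannian CARD('m) \<Longrightarrow>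
      kernel_rank_le (kernel_series c) (L \<inter> U) {w. cnj_vec w \<in> L \<inter> U} N"
  shows "kernel_rank_le (kernel_series c) U {w. cnj_vec w \<in> U} ((N ^ CARD('n)) ^ CARD('n))"
proof -
  let ?K = "kernel_series c" and ?U' = "{w. cnj_vec w \<in> U}"
  note K = kernel_gateaux_holomorphic
  obtain \<epsilon> where \<epsilon>: "\<epsilon> > 0" "polydisc \<epsilon> \<subseteq> U"
    by (rule polydisc_subset_nhd[OF U(1) assms(1)]) (metis order_refl)
  have \<epsilon>': "polydisc \<epsilon> \<subseteq> ?U'"
  proof
    fix w :: "complex ^ 'n" assume "w \<in> polydisc \<epsilon>"
    then have "cnj_vec w \<in> polydisc \<epsilon>" by (simp add: polydisc_def)
    then show "w \<in> ?U'" using \<epsilon>(2) by blast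
  qed
  \<comment> \<open>Polarized base points have radius 3 \<delta>, and a step of size below \<delta>
    in a polarized unit direction adds at most 3 \<delta>.\<close>
  define \<delta> where "\<delta> = \<epsilon> / 6"
  have \<delta>: "\<delta> > 0" "\<epsilon> = 6 * \<delta>"
    using \<epsilon> by (auto simp: \<delta>_def)
  let ?P = "polydisc \<delta> :: (complex ^ 'n) set"
  have PP: "?P \<subseteq> polydisc \<epsilon>"
    using \<delta> by (auto simp: polydisc_def intro: less_trans[of _ \<delta>])
  have P: "?P \<subseteq> U" "?P \<subseteq> ?U'"
    using PP \<epsilon>(2) \<epsilon>' by (simp_all add: order_trans)
  have lines: "kernel_rank_le ?K {z\<in>?P. \<forall>l. l \<noteq> i \<longrightarrow> z $ l = p $ l}
      {w\<in>?P. \<forall>l. l \<noteq> j \<longrightarrow> w $ l = q $ l} N" if p: "p \<in> ?P" and q: "q \<in> ?P" for p q i j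
    unfolding kernel_rank_le_iff_elim
  proof (intro allI impI)
    fix x y :: "nat \<Rightarrow> complex ^ 'n"
    assume x: "range x \<subseteq> {z\<in>?P. \<forall>l. l \<noteq> i \<longrightarrow> z $ l = p $ l}"
      and y: "range y \<subseteq> {w\<in>?P. \<forall>l. l \<noteq> j \<longrightarrow> w $ l = q $ l}"
    \<comment> \<open>With the moving coordinate set to 0, the parameter of a point on the line is
      that coordinate itself.\<close>
    define p0 q0 where "p0 = vec_upd p i 0" and "q0 = vec_upd q j 0"
    define u v :: "complex ^ 'n" where "u = axis i 1" and "v = axis j 1"
    define \<xi> \<eta> where "\<xi> k = x k $ i" and "\<eta> k = y k $ j" for k
    have xk: "x k = p0 + \<xi> k *s u" for k
      using x by (auto simp: vec_eq_iff p0_def u_def \<xi>_def vec_upd_nth axis_def)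
    have yk: "y k = q0 + \<eta> k *s v" for k
      using y by (auto simp: vec_eq_iff q0_def v_def \<eta>_def vec_upd_nth axis_def)
    have bound: "cmod (\<xi> k) < \<delta>" "cmod (\<eta> k) < \<delta>" for k
      using subsetD[OF x rangeI] subsetD[OF y rangeI] by (auto simp: \<xi>_def \<eta>_def polydisc_def)
    have pq: "p0 \<in> ?P" "q0 \<in> ?P"
      using p q \<delta> by (auto simp: p0_def q0_def polydisc_def vec_upd_nth)
    \<comment> \<open>Axis vectors lie on the boundary of the open unit polydisc, so their bound is
      stated for every radius above 1.\<close>
    have uv: "u \<in> polydisc (1 + e)" "v \<in> polydisc (1 + e)" if "e > 0" for e
      using that by (auto simp: u_def v_def polydisc_def axis_def)
    \<comment> \<open>For real \<open>t\<close> the samples \<open>X t k\<close> lie on one line and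
      the \<open>Y t k\<close> on its conjugate; at \<i> they are \<open>x\<close> and
      \<open>y\<close>. This form is affine in \<open>t\<close>, as holomorphy requires, and
      \<open>X_eq\<close> regroups it as a point of the line belonging to \<open>t\<close>.\<close>
    define X where "X t k = (polar_a p0 q0 + \<xi> k *s polar_a u v) + t *s (polar_b p0 q0 + \<xi> k *s polar_b u v)" for t k
    define Y where "Y t k = (cnj_vec (polar_a p0 q0) + \<eta> k *s cnj_vec (polar_a u v)) +
      t *s (cnj_vec (polar_b p0 q0) + \<eta> k *s cnj_vec (polar_b u v))" for t k
    have X_eq: "X t k = (polar_a p0 q0 + t *s polar_b p0 q0) + \<xi> k *s (polar_a u v + t *s polar_b u v)" for t k
      by (simp add: X_def vec_eq_iff algebra_simps del: polar_nth)
    have Y_eq: "Y t k = (cnj_vec (polar_a p0 q0) + t *s cnj_vec (polar_b p0 q0)) +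
        \<eta> k *s (cnj_vec (polar_a u v) + t *s cnj_vec (polar_b u v))" for t k
      by (simp add: Y_def vec_eq_iff algebra_simps del: polar_nth)
    have small: "a + s *s b \<in> polydisc (6 * \<delta>)"
      if "a \<in> polydisc (3 * \<delta>)" "cmod s < \<delta>" "\<And>e. e > 0 \<Longrightarrow> b \<in> polydisc (3 * (1 + e))"
      for a b :: "complex ^ 'n" and s
    proof -
      have "cmod (a $ l + s * b $ l) < 6 * \<delta>" for l
      proof -
        have "cmod (b $ l) \<le> 3"
        proof (rule field_le_epsilon)
          fix e :: real assume "e > 0"
          then show "cmod (b $ l) \<le> 3 + e"
            using that(3)[of "e / 3"] by (auto simp: polydisc_def less_imp_le)
        qed
        then have "cmod (s * b $ l) \<le> \<delta> * 3"
          unfolding norm_mult using that(2) \<delta> by (intro mult_mono) auto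
        then show ?thesis
          using norm_triangle_ineq[of "a $ l" "s * b $ l"] that(1) unfolding polydisc_def
          by (smt (verit) mem_Collect_eq)
      qed
      then show ?thesis by (simp add: polydisc_def)
    qed
    have XP: "X t k \<in> polydisc (6 * \<delta>)" if "cmod t < 2" for t k
      unfolding X_eq using polar_polydisc(1)[OF pq that] bound polar_polydisc(1)[OF uv that]
      by (intro small)
    have YP: "Y t k \<in> polydisc (6 * \<delta>)" if "cmod t < 2" for t k
      unfolding Y_eq using polar_polydisc(2)[OF pq that] bound polar_polydisc(2)[OF uv that]
      by (intro small)
    define g where "g t = elim N ?K (X t) (Y t) (X t N) (Y t N)" for t
    have "g \<i> = 0"
    proof (rule holomorphic_eq_0_real)
      show "g holomorphic_on ball 0 2"
        unfolding g_def
      proof (rule holomorphic_on_elim[where K = "\<lambda>_. ?K" and N = N])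
        show "(\<lambda>t. ?K (X t k) (Y t l)) holomorphic_on ball 0 2" for k l
          unfolding X_def Y_def
        proof (rule gateaux_holomorphic_line[OF K])
          fix t :: complex assume "t \<in> ball 0 2"
          then show "(polar_a p0 q0 + \<xi> k *s polar_a u v) + t *s (polar_b p0 q0 + \<xi> k *s polar_b u v) \<in> U \<and>
            (cnj_vec (polar_a p0 q0) + \<eta> l *s cnj_vec (polar_a u v)) +
             t *s (cnj_vec (polar_b p0 q0) + \<eta> l *s cnj_vec (polar_b u v)) \<in> ?U'"
            using XP[of t k] YP[of t l] \<epsilon>(2) \<epsilon>' unfolding \<delta>(2) X_def Y_def by auto
        qed
      qed auto
      fix t :: real assume t: "\<bar>t\<bar> < 2"
      define a b where "a = polar_a p0 q0 + complex_of_real t *s polar_b p0 q0"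
        and "b = polar_a u v + complex_of_real t *s polar_b u v"
      obtain L where L: "L \<in> affine_grassmannian CARD('m)" "\<And>s. a + s *s b \<in> L"
        using ex_grassmannian_line[OF assms(2,3), of a b] by blast
      have "X t k = a + \<xi> k *s b" for k
        by (simp add: X_eq a_def b_def)
      then have XL: "X t k \<in> L \<inter> U" for k
        using L(2) XP[of "of_real t" k] t \<epsilon>(2) \<delta>(2) by auto
      \<comment> \<open>The same \<open>a\<close> and \<open>b\<close> as for \<open>X t k\<close>,
        with conjugated parameter, so one subspace \<open>L\<close> serves both arguments.\<close>
      have "cnj_vec (Y t k) = a + cnj (\<eta> k) *s b" for k
        unfolding Y_eq polar_real by (simp add: a_def b_def vec_eq_iff algebra_simps del: polar_nth)
      then have YL: "Y t k \<in> {w. cnj_vec w \<in> L \<inter> U}" for k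
        using L(2) YP[of "of_real t" k] t \<epsilon>' \<delta>(2) by auto
      show "g (of_real t) = 0"
        unfolding g_def using XL YL by (intro elim_eq_0[OF rank[OF L(1)]])
    qed
    moreover have "X \<i> = x" "Y \<i> = y"
      unfolding X_eq[abs_def] Y_eq[abs_def] polar_eq using xk yk by auto
    ultimately show "elim N ?K x y (x N) (y N) = 0"
      by (simp add: g_def)
  qed
  have K_P: "gateaux_holomorphic ?K ?P ?P"
    using K P by (rule gateaux_holomorphic_mono)
  \<comment> \<open>The second argument is sliced while the first stays on a line. The outcome is
    the hypothesis on lines for the second round.\<close>
  have 1: "kernel_rank_le ?K {z\<in>?P. \<forall>l. l \<noteq> i \<longrightarrow> z $ l = p $ l} ?P (N ^ CARD('n))" if "p \<in> ?P" for p i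
    by (rule kernel_rank_le_polydisc)
       (use lines[OF that] in \<open>auto intro!: gateaux_holomorphic_line_right[OF K_P]\<close>)
  have "kernel_rank_le (\<lambda>w z. ?K z w) ?P ?P ((N ^ CARD('n)) ^ CARD('n))"
  proof (rule kernel_rank_le_polydisc)
    show "kernel_rank_le (\<lambda>w z. ?K z w) ?P {z\<in>?P. \<forall>l. l \<noteq> i \<longrightarrow> z $ l = p $ l} (N ^ CARD('n))"
      if "p \<in> ?P" for p i
      using 1[OF that] by (rule kernel_rank_le_transpose)
    show "(\<lambda>t. ?K (w + t *s v) a) holomorphic_on S"
      if "a \<in> ?P" "\<And>t. t \<in> S \<Longrightarrow> w + t *s v \<in> ?P" for a w v S
      using gateaux_holomorphic_line_right[OF gateaux_holomorphic_swap[OF K_P]] that by blast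
  qed
  then have "kernel_rank_le ?K ?P ?P ((N ^ CARD('n)) ^ CARD('n))"
    by (rule kernel_rank_le_transpose[where K = "\<lambda>w z. ?K z w"])
  moreover have "0 \<in> ?P"
    using \<delta> by (simp add: polydisc_def)
  ultimately show ?thesis
    using gateaux_kernel_rank_le_extend[OF K U open_cnj_vec[OF U(1)] convex_cnj_vec[OF U(2)]
      open_polydisc P(1) _ open_polydisc P(2)] by blast
qed

end

theorem theorem1p1:
  assumes "CARD('n::finite) \<ge> 2" and "1 \<le> CARD('m::finite)" and "CARD('m) \<le> CARD('n) - 1"
  shows "\<exists>R :: nat \<Rightarrow> nat.
    \<forall>(U :: (complex ^ 'n) set) (r :: complex ^ 'n \<Rightarrow> real).
      open U \<and> convex U \<and> 0 \<in> U \<and> real_analytic_on r U \<and>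
      (\<exists>c. complexified_series r 0 c \<and> series_converges_on c (U \<times> {w. cnj_vec w \<in> U})) \<and>
      (SUP L \<in> affine_grassmannian CARD('m). rank_restrict TYPE('m) r U L) < \<infinity>
      \<longrightarrow>
      rank_on r U < \<infinity> \<and>
      (\<exists>M :: nat.
         ereal (real M) \<in> rank_restrict TYPE('m) r U ` affine_grassmannian CARD('m) \<and>
         (\<forall>L \<in> affine_grassmannian CARD('m). rank_restrict TYPE('m) r U L \<le> ereal (real M)) \<and>
         rank_on r U \<le> enat (R M))"
proof (intro exI[of _ "\<lambda>M. (M ^ CARD('n)) ^ CARD('n)"] allI impI, elim conjE exE)
  fix U :: "(complex ^ 'n) set" and r :: "complex ^ 'n \<Rightarrow> real" and c
  assume U: "open U" "convex U" "0 \<in> U" and r: "real_analytic_on r U"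
    and ser: "complexified_series r 0 c" and conv: "series_converges_on c (U \<times> {w. cnj_vec w \<in> U})"
    and sup: "(SUP L \<in> affine_grassmannian CARD('m). rank_restrict TYPE('m) r U L) < \<infinity>"
  let ?G = "affine_grassmannian CARD('m) :: (complex ^ 'n) set set"
  let ?\<rho> = "rank_restrict TYPE('m) r U"
  obtain \<epsilon> where \<epsilon>: "\<epsilon> > 0" and sum_r: "\<And>z. z \<in> ball 0 \<epsilon> \<Longrightarrow>
      ((\<lambda>(\<alpha>, \<beta>). c \<alpha> \<beta> * monomial z \<alpha> * monomial (cnj_vec z) \<beta>) has_sum complex_of_real (r (0 + z))) UNIV"
    using ser unfolding complexified_series_def by blast
  have near: "complex_of_real (r z) = kernel_series c z (cnj_vec z)" if "z \<in> ball 0 \<epsilon>" for z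
    using infsumI[OF sum_r[OF that]] by (simp add: kernel_series_def)
  note K = gateaux_holomorphic_kernel_series_open[OF U(1) open_cnj_vec[OF U(1)] conv]
  have diag: "complex_of_real (r z) = kernel_series c z (cnj_vec z)" if "z \<in> U" for z
    by (rule real_analytic_on_eq_kernel[OF U r K \<epsilon>(1) near that])
  have vals: "?\<rho> L = -\<infinity> \<or> (\<exists>k::nat. ?\<rho> L = ereal (real k))" if "L \<in> ?G" for L
  proof -
    have "?\<rho> L \<noteq> \<infinity>"
      using SUP_upper[of L ?G ?\<rho>] that sup by auto
    then show ?thesis
      unfolding rank_restrict_def Let_def
      by (auto split: if_splits simp: ereal_of_enat_def split: enat.splits)
  qed
  obtain b where b: "(SUP L \<in> ?G. ?\<rho> L) < ereal (real b)"
    using less_PInf_Ex_of_nat[THEN iffD1, OF less_imp_neq[OF sup]] by blast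
  \<comment> \<open>A bounded set of natural numbers: once it is known to be nonempty, the supremum
    is attained.\<close>
  define S where "S = {k. \<exists>L\<in>?G. ?\<rho> L = ereal (real k)}"
  have "k \<le> b" if "k \<in> S" for k
  proof -
    obtain L where "L \<in> ?G" "?\<rho> L = ereal (real k)"
      using \<open>k \<in> S\<close> unfolding S_def by blast
    then have "ereal (real k) \<le> (SUP L \<in> ?G. ?\<rho> L)"
      using SUP_upper[of L ?G ?\<rho>] by simp
    then have "ereal (real k) < ereal (real b)"
      using b by (rule le_less_trans)
    then show ?thesis by simp
  qed
  then have "S \<subseteq> {..b}" by blast
  then have fin: "finite S" by (rule finite_subset) simp
  have card: "CARD('m) \<le> CARD('n)" using assms by linarith
  \<comment> \<open>A subspace through the origin meets \<open>U\<close>, so some value differs from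
    -\<infinity> and the maximum is a natural number.\<close>
  obtain L0 where L0: "L0 \<in> ?G" "\<And>t. 0 + t *s 0 \<in> L0"
    using ex_grassmannian_line[OF assms(2) card, of 0 0] by blast
  then have "L0 \<inter> U \<noteq> {}"
    using U(3) by auto
  then have "?\<rho> L0 \<noteq> -\<infinity>"
    by (simp add: rank_restrict_def Let_def ereal_of_enat_def split: enat.splits)
  then have "S \<noteq> {}"
    using vals[OF L0(1)] L0(1) by (auto simp: S_def)
  define M where "M = Max S"
  have "M \<in> S"
    unfolding M_def using fin \<open>S \<noteq> {}\<close> by (rule Max_in)
  have le_M: "?\<rho> L \<le> ereal (real M)" if L: "L \<in> ?G" for L
  proof (cases "?\<rho> L = -\<infinity>")
    case False
    then obtain k where k: "?\<rho> L = ereal (real k)" using vals[OF L] by blast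
    then have "k \<le> M"
      unfolding M_def using fin L by (intro Max_ge) (auto simp: S_def)
    then show ?thesis using k by simp
  qed simp
  have "kernel_rank_le (kernel_series c) U {w. cnj_vec w \<in> U} ((M ^ CARD('n)) ^ CARD('n))"
  proof (rule kernel_rank_le_of_restrictions[where ?'m = 'm, OF U(1,2) conv diag U(3) assms(2) card])
    show "kernel_rank_le (kernel_series c) (L \<inter> U) {w. cnj_vec w \<in> L \<inter> U} M" if L: "L \<in> ?G" for L
      by (rule rank_restrict_leD[OF U(1,2) conv diag le_M[OF L] L])
  qed
  then have le: "rank_on r U \<le> enat ((M ^ CARD('n)) ^ CARD('n))"
    using rank_on_le_iff_kernel[OF U(1,2) conv diag] U(3) by blast
  obtain L where "L \<in> ?G" "ereal (real M) = ?\<rho> L"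
    using \<open>M \<in> S\<close> unfolding S_def by auto
  then have "ereal (real M) \<in> ?\<rho> ` ?G"
    by (rule rev_image_eqI)
  moreover have "rank_on r U < \<infinity>"
    using le by (rule le_less_trans) simp
  ultimately show "rank_on r U < \<infinity> \<and> (\<exists>M. ereal (real M) \<in> ?\<rho> ` ?G \<and>
      (\<forall>L\<in>?G. ?\<rho> L \<le> ereal (real M)) \<and> rank_on r U \<le> enat ((M ^ CARD('n)) ^ CARD('n)))"
    using le le_M by blast
qed

end
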